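(* Let $\delta\geq0$ and $\sigma>10^7\delta$. Let $X$ be a length space. If $X$ is $\sigma$-locally $\delta$-hyperbolic and $10^{-5}\sigma$-simply connected, then $X$ is (globally) $300\delta$-hyperbolic.
   Context: For points of a metric space, $\langle x,y\rangle_z=\frac12(|x-z|+|y-z|-|x-y|)$. A metric space is $\delta$-hyperbolic if $\langle x,z\rangle_t\geq\min\{\langle x,y\rangle_t,\langle y,z\rangle_t\}-\delta$ for all points $x,y,z,t$. A length space $X$ is $\sigma$-locally $\delta$-hyperbolic if every ball of radius $\sigma$ is $\delta$-hyperbolic, i.e. the preceding inequality (computed with the metric of $X$) holds for any four points contained in such a ball. $X$ is $r$-simply connected if its fundamental group is normally generated by free homotopy classes of loops of diameter less than $r$. *)

theory Defs
  imports "HOL-Analysis.Analysis" "HOL-Algebra.Coset"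
begin

text \<open>A metric space is represented by a subset \<open>X\<close> of a type of class \<^class>\<open>metric_space\<close>,
  with the restricted metric.\<close>

subsection \<open>Hyperbolicity\<close>

definition gromov_product :: "'a::metric_space \<Rightarrow> 'a \<Rightarrow> 'a \<Rightarrow> real" where
  "gromov_product x y z = (dist x z + dist y z - dist x y) / 2"

definition hyperbolic :: "real \<Rightarrow> 'a::metric_space set \<Rightarrow> bool" where
  "hyperbolic \<delta> X \<longleftrightarrow> (\<forall>x\<in>X. \<forall>y\<in>X. \<forall>z\<in>X. \<forall>t\<in>X.
     gromov_product x z t \<ge> min (gromov_product x y t) (gromov_product y z t) - \<delta>)"

text \<open>In a length space closed balls of positive radius are the closures of the open ones and the
  inequality above passes to closures, so open and closed balls yield the same notion.\<close>

definition locally_hyperbolic :: "real \<Rightarrow> real \<Rightarrow> 'a::metric_space set \<Rightarrow> bool" where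
  "locally_hyperbolic \<sigma> \<delta> X \<longleftrightarrow> (\<forall>c\<in>X. hyperbolic \<delta> (ball c \<sigma> \<inter> X))"

subsection \<open>Length spaces\<close>

definition curve_length :: "(real \<Rightarrow> 'a::metric_space) \<Rightarrow> ennreal" where
  "curve_length g =
     (SUP (n, t) \<in> {(n, t). mono_on {..n} t \<and> t ` {..n} \<subseteq> {0..1}}.
        \<Sum>i<(n::nat). ennreal (dist (g (t i)) (g (t (Suc i)))))"

text \<open>The infimum of the empty set is \<open>\<infinity>\<close>, so any two points of a length space are joined by
  rectifiable paths.\<close>

definition length_space :: "'a::metric_space set \<Rightarrow> bool" where
  "length_space X \<longleftrightarrow> (\<forall>x\<in>X. \<forall>y\<in>X. ennreal (dist x y) =
     (INF g \<in> {g. path g \<and> path_image g \<subseteq> X \<and> pathstart g = x \<and> pathfinish g = y}.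
        curve_length g))"

subsection \<open>The fundamental group\<close>

definition loops_at :: "'a::topological_space set \<Rightarrow> 'a \<Rightarrow> (real \<Rightarrow> 'a) set" where
  "loops_at X a = {p. path p \<and> path_image p \<subseteq> X \<and> pathstart p = a \<and> pathfinish p = a}"

definition loop_rel :: "'a::topological_space set \<Rightarrow> 'a \<Rightarrow> ((real \<Rightarrow> 'a) \<times> (real \<Rightarrow> 'a)) set" where
  "loop_rel X a = {(p, q). p \<in> loops_at X a \<and> q \<in> loops_at X a \<and> homotopic_paths X p q}"

definition fundamental_group :: "'a::topological_space set \<Rightarrow> 'a \<Rightarrow> (real \<Rightarrow> 'a) set monoid" where
  "fundamental_group X a =
     \<lparr>carrier = loops_at X a // loop_rel X a,
      mult = (\<lambda>A B. \<Union>p\<in>A. \<Union>q\<in>B. loop_rel X a `` {p +++ q}),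
      one = loop_rel X a `` {\<lambda>_. a}\<rparr>"

lemma equiv_loop_rel: "equiv (loops_at X a) (loop_rel X a)"
  by (rule equivI)
     (auto simp: refl_on_def sym_def trans_def loop_rel_def loops_at_def
           intro: homotopic_paths_sym homotopic_paths_trans)

lemma const_in_loops_at: "a \<in> X \<Longrightarrow> (\<lambda>_. a) \<in> loops_at X a"
  by (auto simp: loops_at_def path_def path_image_def pathstart_def pathfinish_def)

lemma join_in_loops_at: "p \<in> loops_at X a \<Longrightarrow> q \<in> loops_at X a \<Longrightarrow> p +++ q \<in> loops_at X a"
  using path_image_join_subset[of p q] by (auto simp: loops_at_def)

lemma reversepath_in_loops_at: "p \<in> loops_at X a \<Longrightarrow> reversepath p \<in> loops_at X a"
  by (auto simp: loops_at_def)

lemma homotopic_const_join: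
  assumes "p \<in> loops_at X a"
  shows "homotopic_paths X ((\<lambda>_. a) +++ p) p"
proof -
  have "continuous_on {0..1} (\<lambda>t::real. if t \<le> 1/2 then 0 else 2 * t - 1)"
    unfolding split_01 by (rule continuous_on_cases continuous_intros | force)+
  then have "homotopic_paths X p ((\<lambda>_. a) +++ p)"
    using assms
    by (intro homotopic_paths_reparametrize[where f = "\<lambda>t. if t \<le> 1/2 then 0 else 2 * t - 1"])
       (auto simp: loops_at_def joinpaths_def pathstart_def)
  then show ?thesis by (rule homotopic_paths_sym)
qed

lemma homotopic_reversepath_join:
  assumes "p \<in> loops_at X a"
  shows "homotopic_paths X (reversepath p +++ p) (\<lambda>_. a)"
proof -
  define k :: "real \<Rightarrow> real" where "k s = 1 - \<bar>1 - 2 * s\<bar>" for s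
  define h where "h = (\<lambda>(t, s). p (1 - (1 - t) * k s))"
  have k: "0 \<le> k s" "k s \<le> 1" if "0 \<le> s" "s \<le> 1" for s
    using that by (auto simp: k_def)
  have m: "1 - (1 - t) * k s \<in> {0..1}" if "t \<in> {0..1}" "s \<in> {0..1}" for s t
    using that k[of s] by (auto simp: mult_le_one)
  have p: "continuous_on {0..1} p" "p ` {0..1} \<subseteq> X" "p 0 = a" "p 1 = a"
    using assms by (auto simp: loops_at_def path_def path_image_def pathstart_def pathfinish_def)
  have "continuous_on ({0..1} \<times> {0..1}) h"
    unfolding h_def case_prod_beta k_def
    by (rule continuous_on_compose2[OF p(1)], intro continuous_intros)
       (use m in \<open>auto simp: k_def\<close>)
  moreover have "h \<in> ({0..1} \<times> {0..1}) \<rightarrow> X"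
    using m p(2) by (fastforce simp: h_def)
  moreover have "h (0, s) = (reversepath p +++ p) s" if "s \<in> {0..1}" for s
    by (auto simp: h_def k_def joinpaths_def reversepath_def)
  ultimately show ?thesis
    unfolding homotopic_paths
    by (intro exI[of _ h])
       (auto simp: h_def k_def p pathstart_def pathfinish_def joinpaths_def reversepath_def)
qed

lemma mult_fundamental_group:
  assumes p: "p \<in> loops_at X a" and q: "q \<in> loops_at X a"
  shows "loop_rel X a `` {p} \<otimes>\<^bsub>fundamental_group X a\<^esub> loop_rel X a `` {q} = loop_rel X a `` {p +++ q}"
proof -
  have c: "loop_rel X a `` {p' +++ q'} = loop_rel X a `` {p +++ q}"
    if "p' \<in> loop_rel X a `` {p}" "q' \<in> loop_rel X a `` {q}" for p' q'
  proof -
    have "p' \<in> loops_at X a" "q' \<in> loops_at X a" "homotopic_paths X p p'" "homotopic_paths X q q'"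
      using that by (auto simp: loop_rel_def)
    moreover from this have "homotopic_paths X (p +++ q) (p' +++ q')"
      using p q by (intro homotopic_paths_join) (auto simp: loops_at_def)
    ultimately have "(p +++ q, p' +++ q') \<in> loop_rel X a"
      using p q by (simp add: loop_rel_def join_in_loops_at)
    then show ?thesis
      using equiv_class_eq[OF equiv_loop_rel] by blast
  qed
  have "loop_rel X a `` {p} \<noteq> {}" "loop_rel X a `` {q} \<noteq> {}"
    using p q equiv_class_self[OF equiv_loop_rel] by blast+
  then show ?thesis
    by (simp add: fundamental_group_def c del: Image_singleton_iff cong: SUP_cong)
qed

lemma group_fundamental_group:
  assumes "a \<in> X"
  shows "group (fundamental_group X a)" (is "group ?G")
proof -
  let ?c = "\<lambda>p. loop_rel X a `` {p}"
  have carr: "A \<in> carrier ?G \<longleftrightarrow> (\<exists>p\<in>loops_at X a. A = ?c p)" for A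
    by (auto simp: fundamental_group_def quotient_def)
  have one: "\<one>\<^bsub>?G\<^esub> = ?c (\<lambda>_. a)"
    by (simp add: fundamental_group_def)
  have eq: "?c p = ?c q" if "p \<in> loops_at X a" "q \<in> loops_at X a" "homotopic_paths X p q" for p q
    using that by (intro equiv_class_eq[OF equiv_loop_rel]) (simp add: loop_rel_def)
  show ?thesis
  proof (rule groupI)
    fix A B assume "A \<in> carrier ?G" "B \<in> carrier ?G"
    then show "A \<otimes>\<^bsub>?G\<^esub> B \<in> carrier ?G"
      by (metis carr mult_fundamental_group join_in_loops_at)
  next
    show "\<one>\<^bsub>?G\<^esub> \<in> carrier ?G"
      using const_in_loops_at[OF assms] by (auto simp: carr one)
  next
    fix A B C assume "A \<in> carrier ?G" "B \<in> carrier ?G" "C \<in> carrier ?G"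
    then obtain p q r where pqr: "p \<in> loops_at X a" "q \<in> loops_at X a" "r \<in> loops_at X a"
      and ABC: "A = ?c p" "B = ?c q" "C = ?c r"
      by (auto simp: carr)
    have "homotopic_paths X ((p +++ q) +++ r) (p +++ (q +++ r))"
      using pqr by (intro homotopic_paths_sym[OF homotopic_paths_assoc]) (auto simp: loops_at_def)
    then show "A \<otimes>\<^bsub>?G\<^esub> B \<otimes>\<^bsub>?G\<^esub> C = A \<otimes>\<^bsub>?G\<^esub> (B \<otimes>\<^bsub>?G\<^esub> C)"
      using pqr by (simp add: ABC mult_fundamental_group join_in_loops_at eq)
  next
    fix A assume "A \<in> carrier ?G"
    then obtain p where p: "p \<in> loops_at X a" and A: "A = ?c p"
      by (auto simp: carr)
    show "\<one>\<^bsub>?G\<^esub> \<otimes>\<^bsub>?G\<^esub> A = A"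
      using p const_in_loops_at[OF assms]
      by (simp add: A one mult_fundamental_group join_in_loops_at eq homotopic_const_join)
    have "?c (reversepath p) \<otimes>\<^bsub>?G\<^esub> A = \<one>\<^bsub>?G\<^esub>"
      using p const_in_loops_at[OF assms]
      by (simp add: A one mult_fundamental_group join_in_loops_at reversepath_in_loops_at eq
            homotopic_reversepath_join)
    then show "\<exists>B\<in>carrier ?G. B \<otimes>\<^bsub>?G\<^esub> A = \<one>\<^bsub>?G\<^esub>"
      using reversepath_in_loops_at[OF p] carr by blast
  qed
qed

subsection \<open>Simple connectedness at a given scale\<close>

definition normal_closure :: "('g, 'b) monoid_scheme \<Rightarrow> 'g set \<Rightarrow> 'g set" where
  "normal_closure G S = \<Inter>{N. N \<lhd> G \<and> S \<subseteq> N}"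

text \<open>A free homotopy class of loops determines a conjugacy class in the fundamental group,
  consisting of the elements represented by based loops in that free homotopy class.\<close>

definition short_loop_classes :: "'a::metric_space set \<Rightarrow> 'a \<Rightarrow> real \<Rightarrow> (real \<Rightarrow> 'a) set set" where
  "short_loop_classes X a r = {A \<in> carrier (fundamental_group X a).
     \<exists>p\<in>A. \<exists>q. homotopic_loops X p q \<and> diameter (path_image q) < r}"

definition r_simply_connected :: "real \<Rightarrow> 'a::metric_space set \<Rightarrow> bool" where
  "r_simply_connected r X \<longleftrightarrow> (\<forall>a\<in>X.
     normal_closure (fundamental_group X a) (short_loop_classes X a r)
       = carrier (fundamental_group X a))"

end

theory Submission
  imports Defs
begin

text \<open>This is the Cartan--Hadamard theorem for hyperbolic spaces. Fix a base point \<open>b\<close> and put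
  \<open>s = \<sigma> / 10\<^sup>5\<close>. The plan is to show that geodesics issuing from neighbouring points towards \<open>b\<close>
  stay together, as they do in a tree; this makes the distance to \<open>b\<close> satisfy a four-point inequality
  on every ball of radius \<open>s\<close>, and that property passes from small balls to the whole space.

  A path towards \<open>b\<close> is recorded as a chain: points at successive distances exactly \<open>s\<close>, almost
  straight at every vertex, whose last point lies within \<open>s\<close> of \<open>b\<close>. Inside a hyperbolic ball
  local straightness forces global straightness (\<open>chain_growth\<close>, \<open>chain_between\<close>). Two chains fellow
  travel if each tracks the other up to \<open>5 s\<close>. The tracking is allowed to change the indexing, because
  indices of parallel chains drift apart by an amount proportional to their length. The key point is that a
  tracking with a worse constant improves by itself to the constant \<open>5 s\<close> (\<open>shadows_improve\<close>), by
  thinness of quadrilaterals of bounded size; hence fellow travelling is transitive. Moreover a chain from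
  \<open>x\<close> can be re-straightened, without loss of quality, into a fellow-travelling chain from any point at
  distance at most \<open>s\<close> from \<open>x\<close> (\<open>fellow_lift\<close>). So the classes of chains form a kind of covering of
  \<open>X\<close> whose transport is consistent on sets of diameter at most \<open>2 s\<close>.

  Transport along a path depends only on its homotopy class and is trivial along loops of diameter less
  than \<open>s\<close>. The loops with trivial transport form a normal subgroup of the fundamental group, which is
  everything because \<open>X\<close> is \<open>s\<close>-simply connected (\<open>all_loops_trivial\<close>). Every chain can be transported
  along itself to the constant chain at \<open>b\<close>, so the chains from a given point form one class
  (\<open>unique_chain\<close>).

  Consequently, on a ball of radius \<open>s\<close>, the distance to \<open>b\<close> differs by at most a few \<open>\<delta>\<close> from the
  distance to some point \<open>u\<close> at bounded distance, plus a constant (\<open>distance_from_afar\<close>). With local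
  hyperbolicity this yields the four-point inequality involving \<open>b\<close> and three points of the ball
  (\<open>based_four_point\<close>). Along a geodesic, that inequality lets the distance to \<open>b\<close> only decrease at
  full speed and then increase at full speed, up to a bounded turn. A comparison with a geodesic to \<open>b\<close>
  keeps the total error bounded, however long the geodesic is (\<open>ascending_line\<close>). Therefore geodesic
  triangles are thin (\<open>slim_triangle\<close>), and thinness gives the four-point inequality for all points of
  \<open>X\<close>.\<close>

section \<open>Lifting along homotopies\<close>

lemma path_fine_dyadic:
  fixes g :: "real \<Rightarrow> 'a::metric_space"
  assumes "path g" "0 < s"
  obtains k0 where "\<And>k i. k0 \<le> k \<Longrightarrow> i < 2 ^ k \<Longrightarrow>
      dist (g (real i / 2 ^ k)) (g (real (Suc i) / 2 ^ k)) \<le> s"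
proof -
  have "uniformly_continuous_on {0..1} g"
    using assms(1) by (simp add: path_def compact_uniformly_continuous)
  then obtain e where e: "0 < e" "\<And>x y. x \<in> {0..1} \<Longrightarrow> y \<in> {0..1} \<Longrightarrow> dist y x < e \<Longrightarrow> dist (g y) (g x) < s"
    unfolding uniformly_continuous_on_def using assms(2) by meson
  obtain k0 where k0: "(1/2) ^ k0 < e"
    using real_arch_pow_inv[OF e(1), of "1/2"] by auto
  show thesis
  proof (rule that[of k0])
    fix k i :: nat assume k: "k0 \<le> k" "i < 2 ^ k"
    have "(1/2::real) ^ k \<le> (1/2) ^ k0" using k by (intro power_decreasing) auto
    then have "(1/2::real) ^ k < e" using k0 by linarith
    then have *: "1 / 2 ^ k < e" by (simp add: power_divide)
    have **: "real (Suc i) \<le> 2 ^ k" using k(2) by (metis Suc_leI of_nat_le_iff of_nat_numeral of_nat_power)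
    have "real (Suc i) / 2 ^ k - real i / 2 ^ k = 1 / 2 ^ k"
      by (simp add: field_simps)
    then have "dist (real i / 2 ^ k) (real (Suc i) / 2 ^ k) < e"
      using * by (subst dist_commute) (simp only: dist_real_def, simp)
    moreover have "real i \<le> 2 ^ k" using ** unfolding of_nat_Suc by linarith
    then have "real i / 2 ^ k \<in> {0..1}" "real (Suc i) / 2 ^ k \<in> {0..1}"
      using ** by (simp_all add: divide_le_eq_1)
    ultimately have "dist (g (real i / 2 ^ k)) (g (real (Suc i) / 2 ^ k)) < s"
      by (intro e(2))
    then show "dist (g (real i / 2 ^ k)) (g (real (Suc i) / 2 ^ k)) \<le> s" by simp
  qed
qed

text \<open>The part of covering space theory that is needed, for a total space \<open>S\<close> that is a bare set. The relation
\<open>R u v\<close> says that \<open>u\<close> and \<open>v\<close> lie close together and on the same sheet. It is transitive only as long as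
the projections stay within \<open>2 s\<close>, and lifting is possible over distances up to \<open>s\<close>.\<close>

locale sheets =
  fixes X :: "'a::metric_space set" and s :: real and S :: "'s set" and pr :: "'s \<Rightarrow> 'a"
    and R :: "'s \<Rightarrow> 's \<Rightarrow> bool"
  assumes s_pos: "0 < s"
    and pr_in: "u \<in> S \<Longrightarrow> pr u \<in> X"
    and R_refl: "u \<in> S \<Longrightarrow> R u u"
    and R_sym: "R u v \<Longrightarrow> R v u"
    and R_trans: "u \<in> S \<Longrightarrow> v \<in> S \<Longrightarrow> w \<in> S \<Longrightarrow> R u v \<Longrightarrow> R v w \<Longrightarrow> dist (pr u) (pr w) \<le> 2 * s \<Longrightarrow> R u w"
    and R_lift: "u \<in> S \<Longrightarrow> y \<in> X \<Longrightarrow> dist (pr u) y \<le> s \<Longrightarrow> \<exists>v\<in>S. pr v = y \<and> R u v"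
begin

definition lifts :: "(real \<Rightarrow> 'a) \<Rightarrow> nat \<Rightarrow> (nat \<Rightarrow> 's) \<Rightarrow> bool" where
  "lifts g N u \<longleftrightarrow> (\<forall>k\<le>N. u k \<in> S \<and> pr (u k) = g (real k / real N)) \<and> (\<forall>k<N. R (u k) (u (Suc k)))"

text \<open>Subdivisions into \<open>2 ^ k\<close> pieces are used because the two halves of a concatenation are then again
subdivided dyadically. Only fine subdivisions count, since only these are guaranteed to have lifts.\<close>

definition trivial_holonomy :: "(real \<Rightarrow> 'a) \<Rightarrow> bool" where
  "trivial_holonomy g \<longleftrightarrow> (\<exists>k0. \<forall>k\<ge>k0. \<forall>u. lifts g (2 ^ k) u \<longrightarrow> R (u 0) (u (2 ^ k)))"

lemma lifts_cong:
  assumes "\<And>t. t \<in> {0..1} \<Longrightarrow> g t = g' t" "0 < N"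
  shows "lifts g N u \<longleftrightarrow> lifts g' N u"
proof -
  have "g (real k / real N) = g' (real k / real N)" if "k \<le> N" for k
    using that assms by (intro assms(1)) (auto simp: field_simps)
  then show ?thesis unfolding lifts_def by auto
qed

lemma lifts_exist:
  assumes fine: "\<And>i. i < N \<Longrightarrow> dist (g (real i / real N)) (g (real (Suc i) / real N)) \<le> s"
    and g: "\<And>t. t \<in> {0..1} \<Longrightarrow> g t \<in> X" and u0: "u0 \<in> S" "pr u0 = g 0" and N: "0 < N"
  obtains u where "lifts g N u" "u 0 = u0"
proof -
  have "\<exists>f. \<forall>n. (f n \<in> S \<and> pr (f n) = g (real (min n N) / real N) \<and> (n = 0 \<longrightarrow> f n = u0)) \<and> R (f n) (f (Suc n))"
  proof (rule dependent_nat_choice)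
    show "\<exists>x. x \<in> S \<and> pr x = g (real (min 0 N) / real N) \<and> (0 = (0::nat) \<longrightarrow> x = u0)"
      using u0 by auto
  next
    fix x n assume x: "x \<in> S \<and> pr x = g (real (min n N) / real N) \<and> (n = 0 \<longrightarrow> x = u0)"
    let ?y = "g (real (min (Suc n) N) / real N)"
    have "dist (pr x) ?y \<le> s"
    proof (cases "n < N")
      case True then show ?thesis using x fine[of n] by (auto simp: min_def Suc_leI)
    next
      case False then show ?thesis using x s_pos by (auto simp: min_def)
    qed
    moreover have "?y \<in> X" using N by (intro g) (auto simp: field_simps)
    ultimately show "\<exists>y. (y \<in> S \<and> pr y = ?y \<and> (Suc n = 0 \<longrightarrow> y = u0)) \<and> R x y"
      using R_lift[of x ?y] x by auto
  qed
  then obtain f where f: "\<And>n. f n \<in> S" "\<And>n. pr (f n) = g (real (min n N) / real N)"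
      "f 0 = u0" "\<And>n. R (f n) (f (Suc n))" by blast
  have "lifts g N f" unfolding lifts_def using f by (auto simp: min_def)
  then show thesis using that f(3) by blast
qed

text \<open>The two rungs and the two rails of each square of the ladder have length at most \<open>s\<close>, so its diagonals are
short enough for transitivity.\<close>

lemma parallel_lifts:
  assumes "\<And>k. k \<le> N \<Longrightarrow> u k \<in> S" "\<And>k. k \<le> N \<Longrightarrow> v k \<in> S"
    and "\<And>k. k \<le> N \<Longrightarrow> dist (pr (u k)) (pr (v k)) \<le> s"
    and "\<And>k. k < N \<Longrightarrow> dist (pr (u k)) (pr (u (Suc k))) \<le> s"
    and "\<And>k. k < N \<Longrightarrow> R (u k) (u (Suc k))" "\<And>k. k < N \<Longrightarrow> R (v k) (v (Suc k))"
    and "R (u 0) (v 0)" "k \<le> N"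
  shows "R (u k) (v k)"
  using \<open>k \<le> N\<close>
proof (induction k)
  case 0 then show ?case using assms by simp
next
  case (Suc k)
  then have k: "k < N" and IH: "R (u k) (v k)" by auto
  have "dist (pr (u (Suc k))) (pr (v k)) \<le> 2 * s"
    using assms(3)[of k] assms(4)[of k] k dist_triangle2[of "pr (u (Suc k))" "pr (v k)" "pr (u k)"]
      dist_triangle[of "pr (u (Suc k))" "pr (v k)" "pr (u k)"] by (simp add: dist_commute)
  then have "R (u (Suc k)) (v k)"
    using R_trans[of "u (Suc k)" "u k" "v k"] assms(1,2,5) k IH R_sym by simp
  moreover have "dist (pr (u (Suc k))) (pr (v (Suc k))) \<le> 2 * s"
    using assms(3)[of "Suc k"] k s_pos by simp
  ultimately show ?case
    using R_trans[of "u (Suc k)" "v k" "v (Suc k)"] assms(1,2,6) k by simp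
qed

text \<open>Uniform continuity cuts the homotopy into squares of diameter less than \<open>s\<close>. Lifts of neighbouring rows
that start next to each other stay next to each other; since rows are loops, triviality passes from one row to
the preceding one. The end points of the loops may move, so this covers free homotopies.\<close>

lemma trivial_holonomy_homotopic:
  assumes hom: "homotopic_loops X p q" and q: "trivial_holonomy q"
  shows "trivial_holonomy p"
proof -
  obtain h where hc: "continuous_on ({0..1::real} \<times> {0..1::real}) h"
    and hX: "\<And>x y. x \<in> {0..1} \<Longrightarrow> y \<in> {0..1} \<Longrightarrow> h (x, y) \<in> X"
    and h0: "\<And>x. x \<in> {0..1} \<Longrightarrow> h (0, x) = p x" and h1: "\<And>x. x \<in> {0..1} \<Longrightarrow> h (1, x) = q x"
    and hl: "\<And>t. t \<in> {0..1} \<Longrightarrow> h (t, 1) = h (t, 0)"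
  proof -
    obtain h where "continuous_on ({0..1::real} \<times> {0..1::real}) h" "h \<in> {0..1} \<times> {0..1} \<rightarrow> X"
      "\<forall>x\<in>{0..1}. h (0, x) = p x" "\<forall>x\<in>{0..1}. h (1, x) = q x"
      "\<forall>t\<in>{0..1}. pathfinish (h \<circ> Pair t) = pathstart (h \<circ> Pair t)"
      using hom unfolding homotopic_loops by blast
    then show thesis
      by (intro that[of h]) (auto simp: pathstart_def pathfinish_def Pi_iff)
  qed
  have "uniformly_continuous_on ({0..1} \<times> {0..1}) h"
    using hc by (intro compact_uniformly_continuous compact_Times) auto
  then obtain e where e: "0 < e" "\<And>x y. x \<in> {0..1} \<times> {0..1} \<Longrightarrow> y \<in> {0..1} \<times> {0..1} \<Longrightarrow> dist y x < e \<Longrightarrow> dist (h y) (h x) < s"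
    unfolding uniformly_continuous_on_def using s_pos by meson
  obtain k1 where k1: "(1/2) ^ k1 < e"
    using real_arch_pow_inv[OF e(1), of "1/2"] by auto
  obtain k2 where k2: "\<And>k u. k2 \<le> k \<Longrightarrow> lifts q (2 ^ k) u \<Longrightarrow> R (u 0) (u (2 ^ k))"
    using q unfolding trivial_holonomy_def by blast
  have main: "R (u 0) (u (2 ^ k))" if k: "max k1 k2 \<le> k" and u: "lifts p (2 ^ k) u" for k u
  proof -
    define N :: nat where "N = 2 ^ k"
    have N: "0 < N" by (simp add: N_def)
    have "(1/2::real) ^ k \<le> (1/2) ^ k1" using k by (intro power_decreasing) auto
    then have "(1/2::real) ^ k < e" using k1 by linarith
    then have Ne: "1 / real N < e" by (simp add: power_divide N_def)
    have I: "real i / real N \<in> {0..1}" if "i \<le> N" for i using that N by (auto simp: field_simps)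
    have step: "dist (real i / real N) (real (Suc i) / real N) < e" for i
      using Ne N by (simp add: dist_real_def field_simps)
    have row: "dist (h (real j / N, real i / N)) (h (real j / N, real (Suc i) / N)) \<le> s" if "j \<le> N" "i < N" for i j
      using e(2)[of "(real j / N, real (Suc i) / N)" "(real j / N, real i / N)"] I[of i] I[of "Suc i"] I[of j] that step[of i]
      by (simp add: dist_Pair_Pair)
    have col: "dist (h (real j / N, x)) (h (real (Suc j) / N, x)) \<le> s" if "j < N" "x \<in> {0..1}" for x j
      using e(2)[of "(real (Suc j) / N, x)" "(real j / N, x)"] I[of j] I[of "Suc j"] that step[of j]
      by (simp add: dist_Pair_Pair)
    \<comment> \<open>From the last row, where triviality is the assumption on \<open>q\<close>, downwards to the first.\<close>
    have triv: "\<forall>u. lifts (\<lambda>x. h (real j / N, x)) N u \<longrightarrow> R (u 0) (u N)" if "j \<le> N" for j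
      using that
    proof (induction rule: inc_induct)
      case base
      have "lifts (\<lambda>x. h (real N / N, x)) N u \<longleftrightarrow> lifts q N u" for u
        using N h1 by (intro lifts_cong) auto
      then show ?case using k2[of k] k by (simp add: N_def)
    next
      case (step j)
      show ?case
      proof (intro allI impI)
        fix u assume u: "lifts (\<lambda>x. h (real j / N, x)) N u"
        have uS: "\<And>i. i \<le> N \<Longrightarrow> u i \<in> S" "\<And>i. i \<le> N \<Longrightarrow> pr (u i) = h (real j / N, real i / N)"
          "\<And>i. i < N \<Longrightarrow> R (u i) (u (Suc i))"
          using u unfolding lifts_def by auto
        obtain v0 where v0: "v0 \<in> S" "pr v0 = h (real (Suc j) / N, 0)" "R (u 0) v0"
          using R_lift[of "u 0" "h (real (Suc j) / N, 0)"] uS(1)[of 0] uS(2)[of 0] col[of j 0] step.hyps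
            hX[of "real (Suc j) / N" 0] I[of "Suc j"] by auto
        obtain v where v: "lifts (\<lambda>x. h (real (Suc j) / N, x)) N v" "v 0 = v0"
          using lifts_exist[of N "\<lambda>x. h (real (Suc j) / N, x)" v0] row[of "Suc j"] step.hyps
            hX[of "real (Suc j) / N"] I[of "Suc j"] v0 N by auto
        have vS: "\<And>i. i \<le> N \<Longrightarrow> v i \<in> S" "\<And>i. i \<le> N \<Longrightarrow> pr (v i) = h (real (Suc j) / N, real i / N)"
          "\<And>i. i < N \<Longrightarrow> R (v i) (v (Suc i))"
          using v unfolding lifts_def by auto
        have RN: "R (u N) (v N)"
        proof (rule parallel_lifts[where N = N and u = u and v = v])
          show "dist (pr (u k)) (pr (v k)) \<le> s" if "k \<le> N" for k
            using col[of j "real k / N"] that I[of k] step.hyps by (simp add: uS vS)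
          show "dist (pr (u k)) (pr (u (Suc k))) \<le> s" if "k < N" for k
            using row[of j k] that step.hyps by (simp add: uS)
        qed (use uS vS v v0 in auto)
        have Rv: "R (v 0) (v N)" using step.IH v by blast
        have e1: "pr (u N) = pr (u 0)" "pr (v N) = pr (v 0)"
          using uS(2)[of N] uS(2)[of 0] vS(2)[of N] vS(2)[of 0] N hl[of "real j / N"] hl[of "real (Suc j) / N"]
            I[of j] I[of "Suc j"] step.hyps by auto
        have d1: "dist (pr (u 0)) (pr (v 0)) \<le> s"
          using col[of j 0] step.hyps uS(2)[of 0] vS(2)[of 0] by simp
        have "R (u 0) (v N)"
          using R_trans[of "u 0" "v 0" "v N"] uS vS v v0 Rv e1 d1 s_pos by simp
        then show "R (u 0) (u N)"
          using R_trans[of "u 0" "v N" "u N"] uS vS RN R_sym e1 s_pos by simp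
      qed
    qed
    have "lifts (\<lambda>x. h (real 0 / N, x)) N u \<longleftrightarrow> lifts p N u"
      using N h0 by (intro lifts_cong) auto
    then show ?thesis using triv[of 0] u by (simp add: N_def)
  qed
  then show ?thesis unfolding trivial_holonomy_def by blast
qed

lemma lifts_join:
  assumes u: "lifts (p +++ q) (2 * N) u" and N: "0 < N" and pq: "pathfinish p = pathstart q"
  shows "lifts p N u" "lifts q N (\<lambda>i. u (N + i))"
proof -
  have uS: "\<And>i. i \<le> 2 * N \<Longrightarrow> u i \<in> S" "\<And>i. i \<le> 2 * N \<Longrightarrow> pr (u i) = (p +++ q) (real i / real (2 * N))"
          "\<And>i. i < 2 * N \<Longrightarrow> R (u i) (u (Suc i))"
    using u unfolding lifts_def by auto
  have 1: "(p +++ q) (real i / real (2 * N)) = p (real i / N)" if "i \<le> N" for i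
    using that N by (auto simp: joinpaths_def field_simps)
  have 2: "(p +++ q) (real (N + i) / real (2 * N)) = q (real i / N)" if "i \<le> N" for i
  proof (cases "i = 0")
    case True then show ?thesis using 1[of N] pq N by (simp add: pathstart_def pathfinish_def)
  next
    case False
    then have "real (N + i) / real (2 * N) > 1/2" using N by (simp add: field_simps)
    moreover have "2 * (real (N + i) / real (2 * N)) - 1 = real i / N" using N by (simp add: field_simps)
    ultimately show ?thesis unfolding joinpaths_def by auto
  qed
  show "lifts p N u" unfolding lifts_def using uS 1 by auto
  show "lifts q N (\<lambda>i. u (N + i))" unfolding lifts_def using uS 2 by auto
qed

lemma lifts_reversepath:
  assumes u: "lifts (reversepath g) N u" and N: "0 < N"
  shows "lifts g N (\<lambda>i. u (N - i))"
  unfolding lifts_def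
proof (intro conjI allI impI)
  fix i assume i: "i \<le> N"
  show "u (N - i) \<in> S" using u unfolding lifts_def by simp
  have "pr (u (N - i)) = reversepath g (real (N - i) / N)" using u unfolding lifts_def by simp
  also have "\<dots> = g (real i / N)" using i N by (simp add: reversepath_def of_nat_diff field_simps)
  finally show "pr (u (N - i)) = g (real i / N)" .
next
  fix i assume i: "i < N"
  then have "R (u (N - Suc i)) (u (Suc (N - Suc i)))" using u unfolding lifts_def by simp
  then show "R (u (N - i)) (u (N - Suc i))" using i R_sym by (simp add: Suc_diff_Suc)
qed

lemma trivial_holonomy_join:
  assumes p: "trivial_holonomy p" "p \<in> loops_at X a" and q: "trivial_holonomy q" "q \<in> loops_at X a"
  shows "trivial_holonomy (p +++ q)"
proof -
  obtain k1 k2 where k1: "\<And>k u. k1 \<le> k \<Longrightarrow> lifts p (2 ^ k) u \<Longrightarrow> R (u 0) (u (2 ^ k))"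
    and k2: "\<And>k u. k2 \<le> k \<Longrightarrow> lifts q (2 ^ k) u \<Longrightarrow> R (u 0) (u (2 ^ k))"
    using p q unfolding trivial_holonomy_def by blast
  have "R (u 0) (u (2 ^ k'))" if "Suc (max k1 k2) \<le> k'" and u: "lifts (p +++ q) (2 ^ k') u" for k' u
  proof -
    define k where "k = k' - 1"
    have k: "k' = Suc k" "max k1 k2 \<le> k" using that unfolding k_def by linarith+
    have pf: "pathfinish p = pathstart q" using p q by (auto simp: loops_at_def)
    define N :: nat where "N = 2 ^ k"
    have N: "0 < N" "2 ^ k' = N + N" by (auto simp: N_def k)
    have l: "lifts p N u" "lifts q N (\<lambda>i. u (N + i))"
      using lifts_join[of p q N u] u pf N by (auto simp: mult_2)
    have "R (u 0) (u N)" "R (u N) (u (N + N))"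
      using k1[of k u] k2[of k "\<lambda>i. u (N + i)"] l k by (auto simp: N_def)
    moreover have "pr (u 0) = a" "pr (u (N + N)) = a"
      using l p q N unfolding lifts_def by (auto simp: loops_at_def pathstart_def pathfinish_def)
    moreover have "u 0 \<in> S" "u N \<in> S" "u (N + N) \<in> S"
      using l unfolding lifts_def by auto
    ultimately show ?thesis
      using R_trans[of "u 0" "u N" "u (N + N)"] s_pos N by simp
  qed
  then show ?thesis unfolding trivial_holonomy_def by blast
qed

lemma trivial_holonomy_reversepath:
  assumes p: "trivial_holonomy p"
  shows "trivial_holonomy (reversepath p)"
proof -
  obtain k1 where k1: "\<And>k u. k1 \<le> k \<Longrightarrow> lifts p (2 ^ k) u \<Longrightarrow> R (u 0) (u (2 ^ k))"
    using p unfolding trivial_holonomy_def by blast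
  have "R (u 0) (u (2 ^ k))" if "k1 \<le> k" and u: "lifts (reversepath p) (2 ^ k) u" for k u
    using k1[OF that(1) lifts_reversepath[OF u]] R_sym by simp
  then show ?thesis unfolding trivial_holonomy_def by blast
qed

lemma trivial_holonomy_small:
  assumes "\<And>t t'. t \<in> {0..1} \<Longrightarrow> t' \<in> {0..1} \<Longrightarrow> dist (q t) (q t') \<le> 2 * s"
  shows "trivial_holonomy q"
proof -
  have "R (u 0) (u N)" if u: "lifts q N u" "0 < N" for u N
  proof -
    have uS: "\<And>i. i \<le> N \<Longrightarrow> u i \<in> S" "\<And>i. i \<le> N \<Longrightarrow> pr (u i) = q (real i / N)"
          "\<And>i. i < N \<Longrightarrow> R (u i) (u (Suc i))"
      using u unfolding lifts_def by auto
    have "R (u 0) (u i)" if "i \<le> N" for i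
      using that
    proof (induction i)
      case 0 then show ?case using uS R_refl by simp
    next
      case (Suc i)
      have "dist (pr (u 0)) (pr (u (Suc i))) \<le> 2 * s"
        using assms[of "real 0 / N" "real (Suc i) / N"] Suc.prems \<open>0 < N\<close> uS(2)[of 0] uS(2)[of "Suc i"] by (auto simp: field_simps)
      then show ?case using R_trans[of "u 0" "u i" "u (Suc i)"] Suc uS by simp
    qed
    then show ?thesis by simp
  qed
  then show ?thesis unfolding trivial_holonomy_def by auto
qed

text \<open>The lifts of \<open>p\<close> and of its reverse run in opposite directions over the same path, so they stay on the same
sheet when they meet on the same sheet in the middle. The constant loop makes the four parts of the path equally
long in parameter, so that a dyadic subdivision induces the same subdivision on \<open>p\<close> and on its reverse.\<close>

lemma trivial_holonomy_conjugate:
  assumes p: "p \<in> loops_at X a" and q: "q \<in> loops_at X a" "trivial_holonomy q" and a: "a \<in> X"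
  shows "trivial_holonomy ((p +++ q) +++ reversepath p)"
proof -
  let ?c = "\<lambda>_::real. a"
  have c: "?c \<in> loops_at X a" "trivial_holonomy ?c"
    using const_in_loops_at[OF a] s_pos by (auto intro: trivial_holonomy_small)
  have rp: "reversepath p \<in> loops_at X a" by (rule reversepath_in_loops_at[OF p])
  obtain k1 where k1: "\<And>k i. k1 \<le> k \<Longrightarrow> i < 2 ^ k \<Longrightarrow>
      dist (reversepath p (real i / 2 ^ k)) (reversepath p (real (Suc i) / 2 ^ k)) \<le> s"
    using path_fine_dyadic[of "reversepath p" s] rp s_pos by (auto simp: loops_at_def)
  obtain k2 where k2: "\<And>k u. k2 \<le> k \<Longrightarrow> lifts q (2 ^ k) u \<Longrightarrow> R (u 0) (u (2 ^ k))"
    using q(2) unfolding trivial_holonomy_def by blast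
  obtain k3 where k3: "\<And>k u. k3 \<le> k \<Longrightarrow> lifts ?c (2 ^ k) u \<Longrightarrow> R (u 0) (u (2 ^ k))"
    using c(2) unfolding trivial_holonomy_def by blast
  have "R (u 0) (u (2 ^ k'))"
    if k': "Suc (Suc (k1 + k2 + k3)) \<le> k'" and u: "lifts ((p +++ q) +++ (?c +++ reversepath p)) (2 ^ k') u" for k' u
  proof -
    define k where "k = k' - 2"
    have k: "k' = Suc (Suc k)" "k1 + k2 + k3 \<le> k" using k' unfolding k_def by linarith+
    define N :: nat where "N = 2 ^ k"
    have N: "0 < N" "2 ^ k' = 2 * (2 * N)" by (auto simp: N_def k)
    have l: "lifts (p +++ q) (2 * N) u" "lifts (?c +++ reversepath p) (2 * N) (\<lambda>i. u (2 * N + i))"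
      using lifts_join[of "p +++ q" "?c +++ reversepath p" "2 * N" u] u N
        join_in_loops_at[OF p q(1)] join_in_loops_at[OF c(1) rp] by (auto simp only: loops_at_def mem_Collect_eq)
    have l1: "lifts p N u" "lifts q N (\<lambda>i. u (N + i))"
      using lifts_join[of p q N u] l(1) N p q by (auto simp: loops_at_def)
    have l2: "lifts ?c N (\<lambda>i. u (2 * N + i))" "lifts (reversepath p) N (\<lambda>i. u (2 * N + (N + i)))"
      using lifts_join[of ?c "reversepath p" N "\<lambda>i. u (2 * N + i)"] l(2) N p by (auto simp: loops_at_def pathfinish_def)
    have l3: "lifts (reversepath p) N (\<lambda>i. u (N - i))"
      using lifts_reversepath[of "reversepath p" N u] l1 N by simp
    have R1: "R (u N) (u (2 * N))"
      using k2[of k "\<lambda>i. u (N + i)"] l1 k by (simp add: N_def[symmetric] mult_2)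
    have R2: "R (u (2 * N)) (u (2 * N + N))"
      using k3[of k "\<lambda>i. u (2 * N + i)"] l2 k by (simp add: N_def[symmetric])
    have S: "u N \<in> S" "u (2 * N) \<in> S" "u (2 * N + N) \<in> S" "pr (u N) = a" "pr (u (2 * N + N)) = a"
      using l1(1) l1(2) l2(1) p N unfolding lifts_def by (auto simp: mult_2 loops_at_def pathfinish_def)
    have R3: "R (u (N - 0)) (u (2 * N + (N + 0)))"
      using R_trans[of "u N" "u (2 * N)" "u (2 * N + N)"] R1 R2 S s_pos by simp
    have fine: "dist (reversepath p (real i / N)) (reversepath p (real (Suc i) / N)) \<le> s" if "i < N" for i
      using k1[of k i] k that by (simp add: N_def)
    have "R (u (N - N)) (u (2 * N + (N + N)))"
    proof (rule parallel_lifts[where N = N and u = "\<lambda>i. u (N - i)" and v = "\<lambda>i. u (2 * N + (N + i))" and k = N])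
      show "dist (pr (u (N - k))) (pr (u (N - Suc k))) \<le> s" if "k < N" for k
        using that l3 fine[of k] unfolding lifts_def by simp
    qed (use l2(2) l3 R3 s_pos in \<open>auto simp: lifts_def\<close>)
    then show ?thesis by (simp add: N mult_2 add.assoc)
  qed
  then have t: "trivial_holonomy ((p +++ q) +++ (?c +++ reversepath p))"
    unfolding trivial_holonomy_def by blast
  have "homotopic_paths X ((p +++ q) +++ reversepath p) ((p +++ q) +++ (?c +++ reversepath p))"
    using homotopic_const_join[OF rp] p q rp
    by (intro homotopic_paths_join) (auto simp: loops_at_def homotopic_paths_sym path_image_join)
  then show ?thesis
    using trivial_holonomy_homotopic[OF homotopic_paths_imp_homotopic_loops t] p q rp by (auto simp: loops_at_def)
qed

text \<open>The classes of loops with trivial holonomy form a normal subgroup that contains the classes of short loops.\<close>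

lemma all_loops_trivial:
  assumes sc: "r_simply_connected s X" and a: "a \<in> X" and p: "p \<in> loops_at X a"
  shows "trivial_holonomy p"
proof -
  let ?G = "fundamental_group X a"
  let ?c = "\<lambda>p. loop_rel X a `` {p}"
  define N where "N = {?c p | p. p \<in> loops_at X a \<and> trivial_holonomy p}"
  have grp: "group ?G" by (rule group_fundamental_group[OF a])
  have carr: "A \<in> carrier ?G \<longleftrightarrow> (\<exists>p\<in>loops_at X a. A = ?c p)" for A
    by (auto simp: fundamental_group_def quotient_def)
  have one: "\<one>\<^bsub>?G\<^esub> = ?c (\<lambda>_. a)" by (simp add: fundamental_group_def)
  have rel: "q \<in> loops_at X a \<and> homotopic_loops X q p" if "q \<in> ?c p" for p q
    using that homotopic_paths_imp_homotopic_loops[of X p q]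
    by (auto simp: loop_rel_def loops_at_def homotopic_loops_sym)
  have rel': "homotopic_loops X p q" if "?c p = ?c q" "p \<in> loops_at X a" for p q
    using that rel[of p q] equiv_class_self[OF equiv_loop_rel] by auto
  have eq: "?c p = ?c q" if "p \<in> loops_at X a" "q \<in> loops_at X a" "homotopic_paths X p q" for p q
    using that by (intro equiv_class_eq[OF equiv_loop_rel]) (simp add: loop_rel_def)
  have inv: "inv\<^bsub>?G\<^esub> (?c p) = ?c (reversepath p)" if p: "p \<in> loops_at X a" for p
  proof (rule group.inv_equality[OF grp])
    show "?c (reversepath p) \<otimes>\<^bsub>?G\<^esub> ?c p = \<one>\<^bsub>?G\<^esub>"
      using p const_in_loops_at[OF a]
      by (simp add: one mult_fundamental_group join_in_loops_at reversepath_in_loops_at eq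
            homotopic_reversepath_join)
    show "?c p \<in> carrier ?G" "?c (reversepath p) \<in> carrier ?G"
      using p reversepath_in_loops_at carr by blast+
  qed
  have "N \<lhd> ?G"
    unfolding group.normal_inv_iff[OF grp]
  proof (intro conjI ballI)
    show "subgroup N ?G"
    proof (rule group.subgroupI[OF grp])
      show "N \<subseteq> carrier ?G" using carr by (auto simp: N_def)
      have "trivial_holonomy (\<lambda>_. a)" using s_pos by (intro trivial_holonomy_small) auto
      then show "N \<noteq> {}" using const_in_loops_at[OF a] by (auto simp: N_def)
    next
      fix A assume "A \<in> N"
      then obtain p where p: "p \<in> loops_at X a" "trivial_holonomy p" "A = ?c p" by (auto simp: N_def)
      then show "inv\<^bsub>?G\<^esub> A \<in> N"
        using inv trivial_holonomy_reversepath reversepath_in_loops_at unfolding N_def by blast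
    next
      fix A B assume "A \<in> N" "B \<in> N"
      then obtain p q where pq: "p \<in> loops_at X a" "trivial_holonomy p" "A = ?c p"
          "q \<in> loops_at X a" "trivial_holonomy q" "B = ?c q" by (auto simp: N_def)
      then show "A \<otimes>\<^bsub>?G\<^esub> B \<in> N"
        using mult_fundamental_group trivial_holonomy_join join_in_loops_at unfolding N_def by blast
    qed
  next
    fix A B assume "A \<in> carrier ?G" "B \<in> N"
    then obtain p q where pq: "p \<in> loops_at X a" "A = ?c p"
          "q \<in> loops_at X a" "trivial_holonomy q" "B = ?c q" unfolding N_def carr by blast
    have e: "A \<otimes>\<^bsub>?G\<^esub> B \<otimes>\<^bsub>?G\<^esub> inv\<^bsub>?G\<^esub> A = ?c ((p +++ q) +++ reversepath p)"
      using pq inv by (simp add: mult_fundamental_group join_in_loops_at reversepath_in_loops_at)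
    have "trivial_holonomy ((p +++ q) +++ reversepath p)"
      using trivial_holonomy_conjugate pq a by blast
    moreover have "(p +++ q) +++ reversepath p \<in> loops_at X a"
      using pq by (simp add: join_in_loops_at reversepath_in_loops_at)
    ultimately show "A \<otimes>\<^bsub>?G\<^esub> B \<otimes>\<^bsub>?G\<^esub> inv\<^bsub>?G\<^esub> A \<in> N"
      unfolding e N_def by blast
  qed
  moreover have "short_loop_classes X a s \<subseteq> N"
  proof
    fix A assume "A \<in> short_loop_classes X a s"
    then obtain p q where A: "A \<in> carrier ?G" "p \<in> A" "homotopic_loops X p q" "diameter (path_image q) < s"
      unfolding short_loop_classes_def by blast
    have bq: "bounded (path_image q)"
      using A(3) homotopic_loops_imp_path by (intro compact_imp_bounded compact_path_image) blast
    have "trivial_holonomy q"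
    proof (rule trivial_holonomy_small)
      fix t t' :: real assume "t \<in> {0..1}" "t' \<in> {0..1}"
      then have "dist (q t) (q t') \<le> diameter (path_image q)"
        using bq by (intro diameter_bounded_bound) (auto simp: path_image_def)
      then show "dist (q t) (q t') \<le> 2 * s" using A(4) s_pos by linarith
    qed
    then have tp: "trivial_holonomy p" using trivial_holonomy_homotopic A(3) by blast
    obtain p' where p': "p' \<in> loops_at X a" "A = ?c p'" using A(1) carr by blast
    then have "p \<in> loops_at X a" "A = ?c p"
      using A(2) rel equiv_class_eq[OF equiv_loop_rel, of p' p X a] by auto
    then show "A \<in> N" using tp unfolding N_def by blast
  qed
  ultimately have "normal_closure ?G (short_loop_classes X a s) \<subseteq> N"
    unfolding normal_closure_def by blast
  then have "?c p \<in> N" using sc a p carr unfolding r_simply_connected_def by blast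
  then obtain q where q: "?c p = ?c q" "trivial_holonomy q" "q \<in> loops_at X a" by (auto simp: N_def)
  then show ?thesis using rel'[OF q(1) p] trivial_holonomy_homotopic by blast
qed

definition carries :: "(real \<Rightarrow> 'a) \<Rightarrow> 's \<Rightarrow> 's \<Rightarrow> bool" where
  "carries g u v \<longleftrightarrow> (\<exists>k0. \<forall>k\<ge>k0. \<exists>w. lifts g (2 ^ k) w \<and> w 0 = u \<and> w (2 ^ k) = v)"

definition joined :: "'s \<Rightarrow> 's \<Rightarrow> bool" where
  "joined u v \<longleftrightarrow> (\<exists>g. path g \<and> path_image g \<subseteq> X \<and> carries g u v)"

lemma carriesD:
  assumes "carries g u v"
  shows "u \<in> S" "v \<in> S" "pr u = pathstart g" "pr v = pathfinish g"
proof -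
  obtain k where "\<exists>w. lifts g (2 ^ k) w \<and> w 0 = u \<and> w (2 ^ k) = v"
    using assms unfolding carries_def by (meson order_refl)
  then obtain w where "lifts g (2 ^ k) w" "w 0 = u" "w (2 ^ k) = v" by blast
  then show "u \<in> S" "v \<in> S" "pr u = pathstart g" "pr v = pathfinish g"
    unfolding lifts_def pathstart_def pathfinish_def by auto
qed

lemma carries_join:
  assumes "carries g u v" "carries g' v w"
  shows "carries (g +++ g') u w"
proof -
  have gg: "pathfinish g = pathstart g'" using carriesD[OF assms(1)] carriesD[OF assms(2)] by simp
  obtain k1 k2 where
      k1: "\<And>k. k1 \<le> k \<Longrightarrow> \<exists>y. lifts g (2 ^ k) y \<and> y 0 = u \<and> y (2 ^ k) = v"
    and k2: "\<And>k. k2 \<le> k \<Longrightarrow> \<exists>y. lifts g' (2 ^ k) y \<and> y 0 = v \<and> y (2 ^ k) = w"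
    using assms unfolding carries_def by blast
  have "\<exists>y. lifts (g +++ g') (2 ^ k') y \<and> y 0 = u \<and> y (2 ^ k') = w" if "Suc (max k1 k2) \<le> k'" for k'
  proof -
    define k where "k = k' - 1"
    have k: "k' = Suc k" "max k1 k2 \<le> k" using that unfolding k_def by linarith+
    define N :: nat where "N = 2 ^ k"
    have N: "0 < N" "2 ^ k' = 2 * N" by (auto simp: N_def k)
    obtain y y' where y: "lifts g N y" "y 0 = u" "y N = v" and y': "lifts g' N y'" "y' 0 = v" "y' N = w"
      using k1[of k] k2[of k] k unfolding N_def by auto
    define z where "z i = (if i \<le> N then y i else y' (i - N))" for i
    have "lifts (g +++ g') (2 * N) z"
      unfolding lifts_def
    proof (intro conjI allI impI)
      fix i assume i: "i \<le> 2 * N"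
      show "z i \<in> S" using i y y' by (auto simp: z_def lifts_def)
      show "pr (z i) = (g +++ g') (real i / real (2 * N))"
      proof (cases "i \<le> N")
        case True
        then have "pr (z i) = g (real i / N)" using y by (simp add: z_def lifts_def)
        then show ?thesis using True N by (simp add: joinpaths_def field_simps)
      next
        case False
        then have "pr (z i) = g' (real (i - N) / N)" using y' i by (simp add: z_def lifts_def)
        moreover have "2 * (real i / real (2 * N)) - 1 = real (i - N) / N"
          using False N by (simp add: of_nat_diff field_simps)
        moreover have "real i / real (2 * N) > 1/2" using False N by (simp add: field_simps)
        ultimately show ?thesis unfolding joinpaths_def by simp
      qed
    next
      fix i assume i: "i < 2 * N"
      consider "i < N" | "i = N" | "N < i" by linarith
      then show "R (z i) (z (Suc i))"
      proof cases
        case 1 then show ?thesis using y by (simp add: z_def lifts_def)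
      next
        case 2
        have "R (y' 0) (y' (Suc 0))" using y'(1) N(1) unfolding lifts_def by blast
        then show ?thesis using 2 y y' by (simp add: z_def)
      next
        case 3
        have "R (y' (i - N)) (y' (Suc (i - N)))" using y' i 3 by (simp add: lifts_def)
        then show ?thesis using 3 by (simp add: z_def Suc_diff_le)
      qed
    qed
    moreover have "z 0 = u" "z (2 * N) = w" using y y' N(1) by (auto simp: z_def mult_2)
    ultimately show ?thesis unfolding N(2) by blast
  qed
  then show ?thesis unfolding carries_def by blast
qed

lemma carries_reversepath:
  assumes "carries g u v"
  shows "carries (reversepath g) v u"
proof -
  obtain k1 where
      k1: "\<And>k. k1 \<le> k \<Longrightarrow> \<exists>y. lifts g (2 ^ k) y \<and> y 0 = u \<and> y (2 ^ k) = v"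
    using assms unfolding carries_def by blast
  have "\<exists>y. lifts (reversepath g) (2 ^ k) y \<and> y 0 = v \<and> y (2 ^ k) = u" if k: "k1 \<le> k" for k
  proof -
    obtain y where y: "lifts g (2 ^ k) y" "y 0 = u" "y (2 ^ k) = v" using k1[OF k] by blast
    show ?thesis
      using lifts_reversepath[of "reversepath g" "2 ^ k" y] y
      by (intro exI[of _ "\<lambda>i. y (2 ^ k - i)"]) simp
  qed
  then show ?thesis unfolding carries_def by blast
qed

lemma joined_trans:
  assumes "joined u v" "joined v w"
  shows "joined u w"
proof -
  obtain g g' where g: "path g" "path_image g \<subseteq> X" "carries g u v"
      "path g'" "path_image g' \<subseteq> X" "carries g' v w"
    using assms unfolding joined_def by blast
  have "path (g +++ g')" using g carriesD(4)[OF g(3)] carriesD(3)[OF g(6)] by (intro path_join_imp) auto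
  moreover have "path_image (g +++ g') \<subseteq> X" using g path_image_join_subset[of g g'] by blast
  ultimately show ?thesis using carries_join[OF g(3,6)] unfolding joined_def by blast
qed

lemma joined_sym: "joined u v \<Longrightarrow> joined v u"
  unfolding joined_def by (metis carries_reversepath path_reversepath path_image_reversepath)

lemma joined_step:
  assumes u: "u \<in> S" "v \<in> S" "R u v" and g: "path g" "path_image g \<subseteq> X" "pathstart g = pr u" "pathfinish g = pr v"
    and n: "\<And>t. t \<in> {0..1} \<Longrightarrow> dist (pr u) (g t) \<le> s \<or> dist (pr v) (g t) \<le> s"
    and d: "\<And>t t'. t \<in> {0..1} \<Longrightarrow> t' \<in> {0..1} \<Longrightarrow> dist (g t) (g t') \<le> 2 * s"
  shows "joined u v"
proof -
  have g01: "g 0 = pr u" "g 1 = pr v" using g by (auto simp: pathstart_def pathfinish_def)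
  have "\<exists>y\<in>S. pr y = g t \<and> R u y \<and> R y v" if t: "t \<in> {0..1}" for t
  proof -
    have X: "g t \<in> X" using g t by (auto simp: path_image_def)
    have dd: "dist (pr u) (g t) \<le> 2 * s" "dist (g t) (pr v) \<le> 2 * s" "dist (pr u) (pr v) \<le> 2 * s"
      using d[of 0 t] d[of t 1] d[of 0 1] t g01 by auto
    from n[OF t] show ?thesis
    proof
      assume "dist (pr u) (g t) \<le> s"
      then obtain y where "y \<in> S" "pr y = g t" "R u y" using R_lift[OF u(1) X] by blast
      then show ?thesis using R_trans[of y u v] u dd R_sym by auto
    next
      assume "dist (pr v) (g t) \<le> s"
      then obtain y where "y \<in> S" "pr y = g t" "R v y" using R_lift[OF u(2) X] by blast
      then show ?thesis using R_trans[of u v y] u dd R_sym by auto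
    qed
  qed
  then obtain Y where Y: "\<And>t. t \<in> {0..1} \<Longrightarrow> Y t \<in> S \<and> pr (Y t) = g t \<and> R u (Y t) \<and> R (Y t) v"
    by metis
  have "\<exists>y. lifts g (2 ^ k) y \<and> y 0 = u \<and> y (2 ^ k) = v" for k
  proof -
    define N :: nat where "N = 2 ^ k"
    have N: "0 < N" by (simp add: N_def)
    define y where "y i = (if i = 0 then u else if i = N then v else Y (real i / N))" for i
    have I: "real i / real N \<in> {0..1}" if "i \<le> N" for i using that N by (auto simp: field_simps)
    have yS: "y i \<in> S \<and> pr (y i) = g (real i / N) \<and> R u (y i) \<and> R (y i) v" if "i \<le> N" for i
      using that Y[OF I[of i]] u R_refl g01 N by (auto simp: y_def)
    have "R (y i) (y (Suc i))" if "i < N" for i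
      using that R_trans[of "y i" u "y (Suc i)"] yS[of i] yS[of "Suc i"] u R_sym
        d[of "real i / N" "real (Suc i) / N"] I[of i] I[of "Suc i"] by auto
    then have "lifts g N y" using yS unfolding lifts_def by auto
    moreover have "y 0 = u" "y N = v" using N by (auto simp: y_def)
    ultimately show ?thesis unfolding N_def by blast
  qed
  then show ?thesis using g unfolding joined_def carries_def by blast
qed

text \<open>Since all loops have trivial holonomy, a point has only one preimage, up to \<open>R\<close>, in each component.\<close>

lemma joined_imp_R:
  assumes "r_simply_connected s X" "joined u v" "pr u = pr v"
  shows "R u v"
proof -
  obtain g where g: "path g" "path_image g \<subseteq> X" "carries g u v" using assms(2) unfolding joined_def by blast
  have "g \<in> loops_at X (pr u)" "pr u \<in> X"
    using g carriesD[OF g(3)] assms(3) pr_in by (auto simp: loops_at_def)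
  then have "trivial_holonomy g" using all_loops_trivial[OF assms(1)] by blast
  then obtain k0 where k0: "\<And>k y. k0 \<le> k \<Longrightarrow> lifts g (2 ^ k) y \<Longrightarrow> R (y 0) (y (2 ^ k))"
    unfolding trivial_holonomy_def by blast
  obtain k1 where k1: "\<And>k. k1 \<le> k \<Longrightarrow> \<exists>y. lifts g (2 ^ k) y \<and> y 0 = u \<and> y (2 ^ k) = v"
    using g(3) unfolding carries_def by blast
  show ?thesis using k0[of "max k0 k1"] k1[of "max k0 k1"] by (metis max.cobounded1 max.cobounded2)
qed

end

section \<open>Coarse geodesics and the local four-point inequality\<close>

text \<open>A path whose length exceeds the distance of its end points by less than \<open>e\<close> serves as a geodesic with
error \<open>e\<close>. Partitions with two interior points suffice for all later uses.\<close>

lemma length_space_near_geodesic: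
  assumes "length_space X" "x \<in> X" "y \<in> X" "0 < e"
  shows "\<exists>f. path f \<and> path_image f \<subseteq> X \<and> pathstart f = x \<and> pathfinish f = y \<and>
        (\<forall>a b. 0 \<le> a \<and> a \<le> b \<and> b \<le> 1 \<longrightarrow> dist x (f a) + dist (f a) (f b) + dist (f b) y \<le> dist x y + e)"
proof -
  have "ennreal (dist x y) < ennreal (dist x y + e)"
    using assms(4) by (simp add: ennreal_less_iff)
  moreover have "ennreal (dist x y) =
      (INF g \<in> {g. path g \<and> path_image g \<subseteq> X \<and> pathstart g = x \<and> pathfinish g = y}. curve_length g)"
    using assms(1-3) unfolding length_space_def by blast
  ultimately have "(INF g \<in> {g. path g \<and> path_image g \<subseteq> X \<and> pathstart g = x \<and> pathfinish g = y}. curve_length g)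
      < ennreal (dist x y + e)" by (simp only:)
  then obtain f where f: "path f" "path_image f \<subseteq> X" "pathstart f = x" "pathfinish f = y"
    and len: "curve_length f < ennreal (dist x y + e)"
    unfolding INF_less_iff by blast
  have "dist x (f a) + dist (f a) (f b) + dist (f b) y \<le> dist x y + e" if "0 \<le> a \<and> a \<le> b \<and> b \<le> 1" for a b
  proof -
    define t where "t = (\<lambda>i::nat. if i = 0 then 0 else if i = 1 then a else if i = 2 then b else 1)"
    have "(3, t) \<in> {(n, t). mono_on {..n} t \<and> t ` {..n} \<subseteq> {0..1}}"
      using that by (auto simp: t_def mono_on_def)
    then have "(\<Sum>i<3. ennreal (dist (f (t i)) (f (t (Suc i))))) \<le> curve_length f"
      unfolding curve_length_def by (rule SUP_upper2) simp
    also have "(\<Sum>i<3. ennreal (dist (f (t i)) (f (t (Suc i))))) = ennreal (dist x (f a) + dist (f a) (f b) + dist (f b) y)"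
      using f(3,4) by (simp add: numeral_3_eq_3 t_def pathstart_def pathfinish_def ennreal_plus)
    finally have "ennreal (dist x (f a) + dist (f a) (f b) + dist (f b) y) < ennreal (dist x y + e)"
      using len by (rule le_less_trans)
    then show ?thesis by (subst (asm) ennreal_less_iff) auto
  qed
  then show ?thesis using f by blast
qed

text \<open>The constant \<open>d\<close> stands for a number slightly larger than \<open>\<delta>\<close>: it has to be positive also when \<open>\<delta> = 0\<close>, so
that the errors of near-geodesics can be chosen small compared with it. The radius \<open>100000 * s\<close> is \<open>\<sigma>\<close>, and the
four-point inequality is the one of \<open>\<delta>\<close>-hyperbolicity with the Gromov products written out.\<close>

locale locally_hyperbolic_space =
  fixes X :: "'a::metric_space set" and d s :: real
  assumes d_pos: "0 < d" and s_large: "100 * d \<le> s"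
    and near_geodesic: "\<And>x y e. x \<in> X \<Longrightarrow> y \<in> X \<Longrightarrow> 0 < e \<Longrightarrow>
      \<exists>f. path f \<and> path_image f \<subseteq> X \<and> pathstart f = x \<and> pathfinish f = y \<and>
        (\<forall>a b. 0 \<le> a \<and> a \<le> b \<and> b \<le> 1 \<longrightarrow> dist x (f a) + dist (f a) (f b) + dist (f b) y \<le> dist x y + e)"
    and four_point: "\<And>a b c e. a \<in> X \<Longrightarrow> b \<in> X \<Longrightarrow> c \<in> X \<Longrightarrow> e \<in> X \<Longrightarrow>
      dist a b < 100000 * s \<Longrightarrow> dist a c < 100000 * s \<Longrightarrow> dist a e < 100000 * s \<Longrightarrow>
      dist a c + dist b e \<le> max (dist a b + dist c e) (dist a e + dist b c) + 2 * d"
begin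

lemma s_pos: "0 < s" using d_pos s_large by linarith

lemma point_at:
  assumes "x \<in> X" "y \<in> X" "0 \<le> a" "a \<le> dist x y" "0 < e"
  obtains z where "z \<in> X" "dist x z = a" "dist z y \<le> dist x y - a + e"
proof -
  obtain f where f: "path f" "path_image f \<subseteq> X" "pathstart f = x" "pathfinish f = y"
    "\<And>a b. 0 \<le> a \<Longrightarrow> a \<le> b \<Longrightarrow> b \<le> 1 \<Longrightarrow> dist x (f a) + dist (f a) (f b) + dist (f b) y \<le> dist x y + e"
    using near_geodesic[OF assms(1,2,5)] by blast
  have c: "continuous_on {0..1} (\<lambda>t. dist x (f t))"
    using f(1) unfolding path_def by (intro continuous_intros)
  have "\<exists>t\<ge>0. t \<le> 1 \<and> dist x (f t) = a"
    using f(3,4) assms(3,4) c by (intro IVT') (auto simp: pathstart_def pathfinish_def)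
  then obtain t where t: "0 \<le> t" "t \<le> 1" "dist x (f t) = a" by blast
  have "dist x (f t) + dist (f t) y \<le> dist x y + e" using f(5)[of t t] t by simp
  moreover have "f t \<in> X" using t f(2) by (auto simp: path_image_def)
  ultimately show thesis using that[of "f t"] t by simp
qed

section \<open>Chains\<close>

definition chain :: "(nat \<Rightarrow> 'a) \<Rightarrow> nat \<Rightarrow> bool" where
  "chain p n \<longleftrightarrow> (\<forall>i\<le>n. p i \<in> X) \<and> (\<forall>i<n. dist (p i) (p (Suc i)) = s) \<and>
     (\<forall>i. i + 2 \<le> n \<longrightarrow> 2 * s - 6 * d \<le> dist (p i) (p (i + 2)))"

lemma chain_reverse:
  assumes "chain p n" shows "chain (\<lambda>i. p (n - i)) n"
  unfolding chain_def
proof (intro conjI allI impI)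
  fix i assume i: "i < n"
  then have "dist (p (n - Suc i)) (p (Suc (n - Suc i))) = s" using assms unfolding chain_def by auto
  then show "dist (p (n - i)) (p (n - Suc i)) = s" using i by (simp add: Suc_diff_Suc dist_commute)
next
  fix i assume i: "i + 2 \<le> n"
  then have "2 * s - 6 * d \<le> dist (p (n - (i + 2))) (p (n - (i + 2) + 2))" using assms unfolding chain_def by auto
  moreover have "n - (i + 2) + 2 = n - i" using i by simp
  ultimately show "2 * s - 6 * d \<le> dist (p (n - i)) (p (n - (i + 2)))" by (simp add: dist_commute)
qed (use assms in \<open>auto simp: chain_def\<close>)

lemma chain_shift: "chain p n \<Longrightarrow> k \<le> n \<Longrightarrow> chain (\<lambda>i. p (i + k)) (n - k)"
  unfolding chain_def by (auto simp: add.commute add.left_commute)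

lemma chain_dist_le:
  assumes "chain p n" "i \<le> j" "j \<le> n" shows "dist (p i) (p j) \<le> real (j - i) * s"
  using assms(2,3)
proof (induction j rule: dec_induct)
  case base then show ?case by simp
next
  case (step j)
  have "dist (p i) (p (Suc j)) \<le> dist (p i) (p j) + dist (p j) (p (Suc j))" by (rule dist_triangle)
  also have "\<dots> \<le> real (j - i) * s + s" using step assms(1) unfolding chain_def by auto
  finally show ?case using step by (simp add: Suc_diff_le algebra_simps)
qed

lemma mult_scale_mono: "m \<le> k \<Longrightarrow> real m * s \<le> real k * s"
  using s_pos by (intro mult_right_mono) auto

lemma chain_local_dist:
  assumes "chain p n" "i \<le> j" "j \<le> n" "j - i < 100000" shows "dist (p i) (p j) < 100000 * s"
proof -
  have "dist (p i) (p j) \<le> real (j - i) * s" by (rule chain_dist_le[OF assms(1-3)])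
  also have "\<dots> < 100000 * s" using assms(4) s_pos by (intro mult_strict_right_mono) auto
  finally show ?thesis .
qed

text \<open>Local straightness is global straightness. If the distance from \<open>p i\<close> grew by almost \<open>s\<close> in the step from \<open>p j\<close> to
\<open>p (j + 1)\<close>, then the sum of the distances of \<open>p i\<close> to \<open>p (j + 1)\<close> and of \<open>p j\<close> to \<open>p (j + 2)\<close> clearly exceeds
the distance of \<open>p i\<close> to \<open>p j\<close> plus \<open>s\<close>. By the four-point inequality it is then at most the distance of \<open>p i\<close>
to \<open>p (j + 2)\<close> plus \<open>s + 2 * d\<close>, which makes the distance grow again.\<close>

lemma chain_growth:
  assumes "chain p n" "i \<le> j" "j < n" "j - i < 99999"
  shows "dist (p i) (p j) + s - 8 * d \<le> dist (p i) (p (Suc j))"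
  using assms(2-)
proof (induction j rule: dec_induct)
  case base then show ?case using assms(1) d_pos unfolding chain_def by auto
next
  case (step j)
  have p: "p i \<in> X" "p j \<in> X" "p (Suc j) \<in> X" "p (Suc (Suc j)) \<in> X"
    "dist (p j) (p (Suc j)) = s" "dist (p (Suc j)) (p (Suc (Suc j))) = s"
    "2 * s - 6 * d \<le> dist (p j) (p (Suc (Suc j)))"
    using assms(1) step unfolding chain_def by (auto simp: numeral_2_eq_2)
  have "dist (p i) (p (Suc j)) + dist (p j) (p (Suc (Suc j)))
      \<le> max (dist (p i) (p j) + dist (p (Suc j)) (p (Suc (Suc j)))) (dist (p i) (p (Suc (Suc j))) + dist (p j) (p (Suc j))) + 2 * d"
    using step by (intro four_point p chain_local_dist[OF assms(1)]) auto
  moreover have "dist (p i) (p j) + s - 8 * d \<le> dist (p i) (p (Suc j))" using step by simp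
  ultimately show ?case using p(5-7) d_pos s_large by linarith
qed

lemma chain_dist_ge:
  assumes "chain p n" "i \<le> j" "j \<le> n" "j - i < 99999"
  shows "9 * (real (j - i) * s) \<le> 10 * dist (p i) (p j)"
  using assms(2-)
proof (induction j rule: dec_induct)
  case base then show ?case by simp
next
  case (step j)
  have "dist (p i) (p j) + s - 8 * d \<le> dist (p i) (p (Suc j))"
    using step by (intro chain_growth[OF assms(1)]) auto
  moreover have "real (Suc j - i) * s = real (j - i) * s + s"
    using step by (simp add: Suc_diff_le algebra_simps)
  moreover have "9 * (real (j - i) * s) \<le> 10 * dist (p i) (p j)" using step by simp
  moreover have "9 * (r + s) \<le> 10 * b" if "a + s - 8 * d \<le> b" "9 * r \<le> 10 * a" for a b r
    using that s_large d_pos by argo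
  ultimately show ?case by presburger
qed

lemma chain_growth_backward:
  assumes "chain p n" "j < k" "k \<le> n" "k - j < 99999"
  shows "dist (p (Suc j)) (p k) + s - 8 * d \<le> dist (p j) (p k)"
proof -
  have "Suc (n - Suc j) = n - j" "n - (n - k) = k" "n - (n - Suc j) = Suc j" "n - (n - j) = j"
    using assms by auto
  then show ?thesis
    using chain_growth[OF chain_reverse[OF assms(1)], of "n - k" "n - Suc j"] assms
    by (simp add: dist_commute[of "p k"])
qed

text \<open>The four-point inequality for \<open>p i\<close>, \<open>p j\<close>, \<open>p (j + 1)\<close>, \<open>p k\<close>, with the growth of the distances from \<open>p i\<close>
and from \<open>p k\<close>, gives an error that does not depend on the number of steps.\<close>

lemma chain_between:
  assumes "chain p n" "i \<le> j" "j \<le> k" "k \<le> n" "k - i < 90000"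
  shows "dist (p i) (p j) + dist (p j) (p k) \<le> dist (p i) (p k) + 10 * d"
proof (cases "j = k")
  case True then show ?thesis using d_pos by simp
next
  case False
  have p: "p i \<in> X" "p j \<in> X" "p (Suc j) \<in> X" "p k \<in> X" "dist (p j) (p (Suc j)) = s"
    using assms False unfolding chain_def by auto
  have 1: "dist (p i) (p j) + s - 8 * d \<le> dist (p i) (p (Suc j))"
    using assms False by (intro chain_growth[OF assms(1)]) auto
  have 2: "dist (p (Suc j)) (p k) + s - 8 * d \<le> dist (p j) (p k)"
    using assms False by (intro chain_growth_backward[OF assms(1)]) auto
  have "dist (p i) (p (Suc j)) + dist (p j) (p k)
      \<le> max (dist (p i) (p j) + dist (p (Suc j)) (p k)) (dist (p i) (p k) + dist (p j) (p (Suc j))) + 2 * d"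
    using assms False by (intro four_point p chain_local_dist[OF assms(1)]) auto
  then show ?thesis using 1 2 p(5) d_pos s_large by linarith
qed

text \<open>A discrete intermediate value theorem for a sequence with increments at most \<open>c\<close>.\<close>

lemma discrete_level:
  fixes f :: "nat \<Rightarrow> real"
  assumes "i \<le> k" "f i \<le> v" "\<And>j. i \<le> j \<Longrightarrow> j < k \<Longrightarrow> f (Suc j) \<le> f j + c" "v \<le> f k + r" "0 \<le> r" "c \<le> 2 * r"
  shows "\<exists>j. i \<le> j \<and> j \<le> k \<and> \<bar>f j - v\<bar> \<le> r"
proof (cases "f k \<le> v")
  case True then show ?thesis using assms by (intro exI[of _ k]) auto
next
  case False
  define j where "j = (LEAST j. i \<le> j \<and> v \<le> f j)"
  have ex: "i \<le> k \<and> v \<le> f k" using assms(1) False by simp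
  have j: "i \<le> j" "v \<le> f j" "j \<le> k"
    using LeastI[where P = "\<lambda>j. i \<le> j \<and> v \<le> f j", OF ex] Least_le[where P = "\<lambda>j. i \<le> j \<and> v \<le> f j", OF ex]
    unfolding j_def by blast+
  show ?thesis
  proof (cases "f j \<le> v + r")
    case True then show ?thesis using j assms(5) by (intro exI[of _ j]) auto
  next
    case F: False
    have "i \<noteq> j" using F assms by auto
    then obtain l where l: "j = Suc l" "i \<le> l" using j by (cases j) auto
    have "\<not> v \<le> f l" using not_less_Least[of l "\<lambda>j. i \<le> j \<and> v \<le> f j"] l unfolding j_def[symmetric] by auto
    moreover have "f j \<le> f l + c" using assms(3)[of l] l j by simp
    ultimately show ?thesis using F l j assms(6) by (intro exI[of _ l]) auto
  qed
qed

text \<open>A point with a small Gromov product with respect to two vertices of a chain is close to the vertex at the same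
distance from the first one. The spacing of the chain contributes \<open>s / 2\<close>, hyperbolicity only \<open>16 * d\<close>.\<close>

lemma near_chain_le:
  assumes "chain q m" "j1 \<le> j2" "j2 \<le> m" "j2 - j1 < 50000" "z \<in> X" "dist z (q j1) < 40000 * s"
    and z: "dist z (q j1) + dist z (q j2) \<le> dist (q j1) (q j2) + 14 * d"
  shows "\<exists>j. j1 \<le> j \<and> j \<le> j2 \<and> dist z (q j) \<le> s"
proof -
  have qX: "\<And>j. j \<le> m \<Longrightarrow> q j \<in> X" using assms(1) unfolding chain_def by auto
  have "\<exists>j. j1 \<le> j \<and> j \<le> j2 \<and> \<bar>dist (q j1) (q j) - dist z (q j1)\<bar> \<le> s / 2"
  proof (rule discrete_level)
    fix j assume "j1 \<le> j" "j < j2"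
    then have "dist (q j) (q (Suc j)) = s" using assms unfolding chain_def by auto
    then show "dist (q j1) (q (Suc j)) \<le> dist (q j1) (q j) + s" using dist_triangle[of "q j1" "q (Suc j)" "q j"] by simp
  next
    show "dist z (q j1) \<le> dist (q j1) (q j2) + s / 2" using z s_large d_pos zero_le_dist[of z "q j2"] by linarith
  qed (use assms s_pos in auto)
  then obtain j where j: "j1 \<le> j" "j \<le> j2" "\<bar>dist (q j1) (q j) - dist z (q j1)\<bar> \<le> s / 2" by blast
  have b: "dist (q j1) (q j) + dist (q j) (q j2) \<le> dist (q j1) (q j2) + 10 * d"
    using j assms by (intro chain_between[OF assms(1)]) auto
  have l: "dist (q j1) (q j) < 50000 * s" "dist (q j1) (q j2) < 50000 * s"
  proof -
    have "dist (q j1) (q j) \<le> real (j - j1) * s" "dist (q j1) (q j2) \<le> real (j2 - j1) * s"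
      using j assms by (intro chain_dist_le[OF assms(1)]; simp)+
    moreover have "real (j - j1) * s < 50000 * s" "real (j2 - j1) * s < 50000 * s"
      using j assms s_pos by (auto intro!: mult_strict_right_mono)
    ultimately show "dist (q j1) (q j) < 50000 * s" "dist (q j1) (q j2) < 50000 * s" by linarith+
  qed
  have "dist z (q j) + dist (q j1) (q j2) \<le> max (dist z (q j1) + dist (q j) (q j2)) (dist z (q j2) + dist (q j1) (q j)) + 2 * d"
  proof (rule four_point)
    show "dist z (q j) < 100000 * s" using dist_triangle[of z "q j" "q j1"] l assms(6) s_pos by linarith
    show "dist z (q j2) < 100000 * s" using dist_triangle[of z "q j2" "q j1"] l assms(6) s_pos by linarith
    show "dist z (q j1) < 100000 * s" using assms(6) s_pos by linarith
  qed (use assms j qX in auto)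
  moreover have "dist (q j1) (q j) - dist z (q j1) \<le> s / 2" "dist z (q j1) - dist (q j1) (q j) \<le> s / 2"
    using j(3) by linarith+
  ultimately have "dist z (q j) \<le> s / 2 + 16 * d" using b z d_pos by linarith
  then show ?thesis using j s_large d_pos by (intro exI[of _ j]) auto
qed

lemma near_chain:
  assumes "chain q m" "j1 \<le> m" "j2 \<le> m" "j2 - j1 < 50000" "j1 - j2 < 50000" "z \<in> X"
    "dist z (q j1) < 40000 * s" "dist z (q j2) < 40000 * s"
    and z: "dist z (q j1) + dist z (q j2) \<le> dist (q j1) (q j2) + 14 * d"
  shows "\<exists>j. min j1 j2 \<le> j \<and> j \<le> max j1 j2 \<and> dist z (q j) \<le> s"
proof (cases "j1 \<le> j2")
  case True then show ?thesis using near_chain_le[OF assms(1), of j1 j2 z] assms by auto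
next
  case False then show ?thesis using near_chain_le[OF assms(1), of j2 j1 z] assms by (auto simp: dist_commute add.commute)
qed

text \<open>The numbers \<open>k\<close> are twice Gromov products at \<open>z\<close>: if \<open>(a | b) \<le> k / 2\<close> while \<open>(a | c) > k / 2 + d\<close>, then the
minimum of \<open>(a | c)\<close> and \<open>(c | b)\<close> can only be attained at \<open>(c | b)\<close>.\<close>

lemma small_product_transfer:
  assumes "z \<in> X" "a \<in> X" "b \<in> X" "c \<in> X" "dist z a < 100000 * s" "dist z b < 100000 * s" "dist z c < 100000 * s"
    and ab: "dist z a + dist z b \<le> dist a b + k" and ac: "k + 2 * d < dist z a + dist z c - dist a c"
  shows "dist z c + dist z b \<le> dist c b + k + 2 * d"
proof -
  have "dist z a + dist c b \<ge> dist z c + dist a b - 2 * d \<or> dist z b + dist a c \<ge> dist z c + dist a b - 2 * d"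
    using four_point[of z a c b] assms by (auto simp: max_def dist_commute split: if_splits)
  then show ?thesis using ab ac by linarith
qed

section \<open>Fellow-travelling chains\<close>

text \<open>The indices of \<open>p\<close> are matched with indices of \<open>q\<close> by a map of bounded jumps. Bounded jumps make the tracking follow
the chain \<open>q\<close> itself rather than its trace in \<open>X\<close>, which may return to the same place on another sheet. The ends
are matched only up to \<open>J\<close>, so that a chain with a single point can be matched with a short one. Monotonicity is
not imposed, so that the vertex matched to \<open>p i\<close> may be chosen independently for each \<open>i\<close>.\<close>

definition shadows :: "real \<Rightarrow> nat \<Rightarrow> (nat \<Rightarrow> 'a) \<Rightarrow> nat \<Rightarrow> (nat \<Rightarrow> 'a) \<Rightarrow> nat \<Rightarrow> bool" where
  "shadows D J p n q m \<longleftrightarrow> (\<exists>\<phi>. (\<forall>i\<le>n. \<phi> i \<le> m \<and> dist (p i) (q (\<phi> i)) \<le> D) \<and>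
     (\<forall>i<n. \<phi> i \<le> \<phi> (Suc i) + J \<and> \<phi> (Suc i) \<le> \<phi> i + J) \<and> \<phi> 0 \<le> J \<and> m \<le> \<phi> n + J)"

lemma jump_bound:
  fixes \<phi> :: "nat \<Rightarrow> nat"
  assumes "\<forall>i<n. \<phi> i \<le> \<phi> (Suc i) + J \<and> \<phi> (Suc i) \<le> \<phi> i + J" "i \<le> j" "j \<le> n"
  shows "\<phi> i \<le> \<phi> j + (j - i) * J" "\<phi> j \<le> \<phi> i + (j - i) * J"
proof -
  have "\<phi> i \<le> \<phi> j + (j - i) * J \<and> \<phi> j \<le> \<phi> i + (j - i) * J"
    using assms(2,3)
  proof (induction j rule: dec_induct)
    case base then show ?case by simp
  next
    case (step j)
    have "\<phi> j \<le> \<phi> (Suc j) + J" "\<phi> (Suc j) \<le> \<phi> j + J" using assms(1) step by auto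
    moreover have "(Suc j - i) * J = (j - i) * J + J" using step by (simp add: Suc_diff_le)
    ultimately show ?case using step by auto
  qed
  then show "\<phi> i \<le> \<phi> j + (j - i) * J" "\<phi> j \<le> \<phi> i + (j - i) * J" by auto
qed

lemma shadows_comp:
  assumes "shadows D J p n q m" "shadows D' J' q m r l"
  shows "shadows (D + D') (J * J' + J') p n r l"
proof -
  obtain \<phi> where f: "\<And>i. i \<le> n \<Longrightarrow> \<phi> i \<le> m" "\<And>i. i \<le> n \<Longrightarrow> dist (p i) (q (\<phi> i)) \<le> D"
    "\<And>i. i < n \<Longrightarrow> \<phi> i \<le> \<phi> (Suc i) + J" "\<And>i. i < n \<Longrightarrow> \<phi> (Suc i) \<le> \<phi> i + J" "\<phi> 0 \<le> J" "m \<le> \<phi> n + J"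
    using assms(1) unfolding shadows_def by blast
  obtain \<psi> where g: "\<And>i. i \<le> m \<Longrightarrow> \<psi> i \<le> l" "\<And>i. i \<le> m \<Longrightarrow> dist (q i) (r (\<psi> i)) \<le> D'"
    "\<forall>i<m. \<psi> i \<le> \<psi> (Suc i) + J' \<and> \<psi> (Suc i) \<le> \<psi> i + J'" "\<psi> 0 \<le> J'" "l \<le> \<psi> m + J'"
    using assms(2) unfolding shadows_def by blast
  have jump: "\<psi> i \<le> \<psi> j + J * J'" if "i \<le> m" "j \<le> m" "i \<le> j + J" "j \<le> i + J" for i j
  proof (cases "i \<le> j")
    case True
    have "(j - i) * J' \<le> J * J'" using that by (intro mult_right_mono) auto
    then show ?thesis using jump_bound(1)[OF g(3) True that(2)] by linarith
  next
    case False
    have "(i - j) * J' \<le> J * J'" using that by (intro mult_right_mono) auto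
    then show ?thesis using jump_bound(2)[OF g(3), of j i] that False by linarith
  qed
  show ?thesis
    unfolding shadows_def
  proof (intro exI[of _ "\<psi> \<circ> \<phi>"] conjI allI impI)
    fix i assume i: "i \<le> n"
    show "(\<psi> \<circ> \<phi>) i \<le> l" using f(1)[OF i] g(1) by simp
    show "dist (p i) (r ((\<psi> \<circ> \<phi>) i)) \<le> D + D'"
      using f(1,2)[OF i] g(2)[of "\<phi> i"] dist_triangle[of "p i" "r (\<psi> (\<phi> i))" "q (\<phi> i)"] by simp
  next
    fix i assume i: "i < n"
    show "(\<psi> \<circ> \<phi>) i \<le> (\<psi> \<circ> \<phi>) (Suc i) + (J * J' + J')"
      "(\<psi> \<circ> \<phi>) (Suc i) \<le> (\<psi> \<circ> \<phi>) i + (J * J' + J')"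
      using jump[of "\<phi> i" "\<phi> (Suc i)"] jump[of "\<phi> (Suc i)" "\<phi> i"] f(1)[of i] f(1)[of "Suc i"] f(3,4)[of i] i by auto
  next
    show "(\<psi> \<circ> \<phi>) 0 \<le> J * J' + J'" using jump[of "\<phi> 0" 0] f(1)[of 0] f(5) g(4) by auto
    show "l \<le> (\<psi> \<circ> \<phi>) n + (J * J' + J')" using jump[of m "\<phi> n"] f(1)[of n] f(6) g(5) by auto
  qed
qed

lemma shadows_mono:
  assumes "shadows D J p n q m" "D \<le> D'" "J \<le> J'"
  shows "shadows D' J' p n q m"
proof -
  obtain \<phi> where f: "\<And>i. i \<le> n \<Longrightarrow> \<phi> i \<le> m \<and> dist (p i) (q (\<phi> i)) \<le> D"
    "\<And>i. i < n \<Longrightarrow> \<phi> i \<le> \<phi> (Suc i) + J \<and> \<phi> (Suc i) \<le> \<phi> i + J" "\<phi> 0 \<le> J" "m \<le> \<phi> n + J"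
    using assms(1) unfolding shadows_def by blast
  show ?thesis
    unfolding shadows_def
  proof (intro exI[of _ \<phi>] conjI allI impI)
    fix i assume "i \<le> n"
    from f(1)[OF this] show "\<phi> i \<le> m" "dist (p i) (q (\<phi> i)) \<le> D'" using assms(2) by linarith+
  next
    fix i assume "i < n"
    from f(2)[OF this] show "\<phi> i \<le> \<phi> (Suc i) + J'" "\<phi> (Suc i) \<le> \<phi> i + J'" using assms(3) by linarith+
  qed (use f assms in linarith)+
qed

lemma chain_index_close:
  assumes "chain q m" "j \<le> m" "j' \<le> m" "dist (q j) (q j') \<le> 11 * s" "j < j' + 50000" "j' < j + 50000"
  shows "j \<le> j' + 12" "j' \<le> j + 12"
proof -
  have "l' \<le> l + 12" if "l \<le> l'" "l' \<le> m" "dist (q l) (q l') \<le> 11 * s" "l' < l + 50000" for l l'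
  proof -
    have "9 * (real (l' - l) * s) \<le> 10 * dist (q l) (q l')"
      using that by (intro chain_dist_ge[OF assms(1)]) auto
    then have "(9 * real (l' - l)) * s \<le> 110 * s" using that(3) unfolding mult.assoc by linarith
    then have "9 * real (l' - l) \<le> 110" using s_pos by (simp only: mult_le_cancel_right_pos)
    then have "real (l' - l) < 13" by linarith
    then show ?thesis by linarith
  qed
  from this[of j j'] this[of j' j] assms show "j \<le> j' + 12" "j' \<le> j + 12"
    by (cases "j \<le> j'"; simp add: dist_commute)+
qed

text \<open>Fix \<open>i\<close> and go \<open>16\<close> steps along \<open>p\<close> in both directions. That distance is at least \<open>14.4 s\<close>, which exceeds the
tracking constant \<open>14 s\<close>; so the matched vertices of \<open>q\<close> have a small Gromov product at \<open>p i\<close>, and \<open>q\<close> passes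
close to \<open>p i\<close> in between. Near the ends of \<open>p\<close> the end points of \<open>q\<close> take over. The jumps of the new
matching are controlled because a chain cannot return to the same place within \<open>10\<^sup>5\<close> steps.
The constants \<open>14 s\<close> and \<open>300\<close> leave room for the composition of two matchings with constants \<open>5 s\<close> and \<open>12\<close>,
and for the matchings that arise when the starting point of a chain is moved.\<close>

lemma shadows_improve:
  assumes p: "chain p n" and q: "chain q m" and sh: "shadows (14 * s) 300 p n q m"
    and e0: "dist (p 0) (q 0) \<le> 2 * s" and e1: "dist (p n) (q m) \<le> 2 * s"
  shows "shadows (5 * s) 12 p n q m"
proof -
  obtain \<phi> where f: "\<And>i. i \<le> n \<Longrightarrow> \<phi> i \<le> m" "\<And>i. i \<le> n \<Longrightarrow> dist (p i) (q (\<phi> i)) \<le> 14 * s"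
    and fj: "\<forall>i<n. \<phi> i \<le> \<phi> (Suc i) + 300 \<and> \<phi> (Suc i) \<le> \<phi> i + 300" and f0: "\<phi> 0 \<le> 300" and f1: "m \<le> \<phi> n + 300"
    using sh unfolding shadows_def by blast
  have pX: "\<And>i. i \<le> n \<Longrightarrow> p i \<in> X" and qX: "\<And>i. i \<le> m \<Longrightarrow> q i \<in> X" using p q unfolding chain_def by auto
  have sd: "8 * d < s / 10" using s_large d_pos by linarith
  have "\<exists>j\<le>m. dist (p i) (q j) \<le> 5 * s \<and> j \<le> \<phi> i + 5100 \<and> \<phi> i \<le> j + 5100" if i: "i \<le> n" for i
  proof -
    obtain ia ja where a: "ia \<le> i" "i \<le> ia + 16" "ja \<le> m" "ja \<le> \<phi> i + 5100" "\<phi> i \<le> ja + 5100"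
       "dist (p ia) (q ja) \<le> 14 * s" "dist (p ia) (q ja) + 8 * d < dist (p i) (p ia) \<or> dist (p i) (q ja) \<le> 5 * s"
    proof (cases "i < 16")
      case True
      have "\<phi> i \<le> \<phi> 0 + (i - 0) * 300" using jump_bound(2)[OF fj, of 0 i] i by blast
      then have "\<phi> i \<le> 0 + 5100" using True f0 by linarith
      moreover have "dist (p 0) (q 0) + 8 * d < dist (p i) (p 0) \<or> dist (p i) (q 0) \<le> 5 * s"
        using dist_triangle[of "p i" "q 0" "p 0"] e0 sd s_pos by linarith
      ultimately show thesis using True e0 s_pos that[of 0 0] by auto
    next
      case False
      have "9 * (real (i - (i - 16)) * s) \<le> 10 * dist (p (i - 16)) (p i)"
        using i False by (intro chain_dist_ge[OF p]) auto
      moreover have "real (i - (i - 16)) = 16" using False by simp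
      ultimately have "72 / 5 * s \<le> dist (p i) (p (i - 16))" by (simp add: dist_commute)
      moreover have "dist (p (i - 16)) (q (\<phi> (i - 16))) \<le> 14 * s" using f i by simp
      ultimately have "dist (p (i - 16)) (q (\<phi> (i - 16))) + 8 * d < dist (p i) (p (i - 16))" using sd s_pos by argo
      then show thesis
        using False i f[of "i - 16"] jump_bound[OF fj, of "i - 16" i] that[of "i - 16" "\<phi> (i - 16)"] by auto
    qed
    obtain ib jb where b: "i \<le> ib" "ib \<le> i + 16" "ib \<le> n" "jb \<le> m" "jb \<le> \<phi> i + 5100" "\<phi> i \<le> jb + 5100"
       "dist (p ib) (q jb) \<le> 14 * s" "dist (p ib) (q jb) + 8 * d < dist (p i) (p ib) \<or> dist (p i) (q jb) \<le> 5 * s"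
    proof (cases "n < i + 16")
      case True
      have "\<phi> n \<le> \<phi> i + (n - i) * 300" using jump_bound(2)[OF fj i] by blast
      then have "m \<le> \<phi> i + 5100" using True f1 by linarith
      moreover have "dist (p n) (q m) + 8 * d < dist (p i) (p n) \<or> dist (p i) (q m) \<le> 5 * s"
        using dist_triangle[of "p i" "q m" "p n"] e1 sd s_pos by linarith
      ultimately show thesis using True e1 s_pos i f(1)[OF i] that[of n m] by auto
    next
      case False
      have "9 * (real (i + 16 - i) * s) \<le> 10 * dist (p i) (p (i + 16))"
        using i False by (intro chain_dist_ge[OF p]) auto
      then have "72 / 5 * s \<le> dist (p i) (p (i + 16))" by simp
      moreover have "dist (p (i + 16)) (q (\<phi> (i + 16))) \<le> 14 * s" using f False by simp
      ultimately have "dist (p (i + 16)) (q (\<phi> (i + 16))) + 8 * d < dist (p i) (p (i + 16))" using sd s_pos by argo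
      then show thesis
        using False i f[of "i + 16"] jump_bound[OF fj, of i "i + 16"] that[of "i + 16" "\<phi> (i + 16)"] by auto
    qed
    show ?thesis
    proof (cases "dist (p i) (q ja) \<le> 5 * s \<or> dist (p i) (q jb) \<le> 5 * s")
      case True then show ?thesis using a b by blast
    next
      case False
      let ?z = "p i"
      have A: "dist (p ia) (q ja) + 8 * d < dist ?z (p ia)" and B: "dist (p ib) (q jb) + 8 * d < dist ?z (p ib)"
        using False a b by auto
      have X: "?z \<in> X" "p ia \<in> X" "p ib \<in> X" "q ja \<in> X" "q jb \<in> X" using pX qX a b i by auto
      have "dist (p ia) ?z \<le> real (i - ia) * s" "dist ?z (p ib) \<le> real (ib - i) * s"
        using a b i by (intro chain_dist_le[OF p]; simp)+
      moreover have "real (i - ia) * s \<le> real 16 * s" "real (ib - i) * s \<le> real 16 * s"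
        using a b by (intro mult_scale_mono; simp)+
      ultimately have l: "dist ?z (p ia) \<le> 16 * s" "dist ?z (p ib) \<le> 16 * s" by (auto simp: dist_commute)
      have l': "dist ?z (q ja) \<le> 30 * s" "dist ?z (q jb) \<le> 30 * s"
        using l a(6) b(7) dist_triangle[of ?z "q ja" "p ia"] dist_triangle[of ?z "q jb" "p ib"] by linarith+
      have t: "dist ?z (p ia) - dist (p ia) (q ja) \<le> dist ?z (q ja)" "dist ?z (p ib) - dist (p ib) (q jb) \<le> dist ?z (q jb)"
        using dist_triangle[of ?z "p ia" "q ja"] dist_triangle[of ?z "p ib" "q jb"] by (auto simp: dist_commute)
      have 0: "dist ?z (p ia) + dist ?z (p ib) \<le> dist (p ia) (p ib) + 10 * d"
        using chain_between[OF p, of ia i ib] a b by (simp add: dist_commute)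
      have 1: "dist ?z (q ja) + dist ?z (p ib) \<le> dist (q ja) (p ib) + 10 * d + 2 * d"
        using X l l' A t 0 s_pos d_pos by (intro small_product_transfer[of _ "p ia"]) linarith+
      have "dist ?z (q jb) + dist ?z (q ja) \<le> dist (q jb) (q ja) + 12 * d + 2 * d"
        using X l l' B t 1 s_pos d_pos by (intro small_product_transfer[of _ "p ib"]) (linarith | simp add: dist_commute add.commute)+
      then have "dist ?z (q ja) + dist ?z (q jb) \<le> dist (q ja) (q jb) + 14 * d" by (simp add: dist_commute)
      then have "\<exists>j. min ja jb \<le> j \<and> j \<le> max ja jb \<and> dist ?z (q j) \<le> s"
        using a b l' X s_pos by (intro near_chain[OF q]) linarith+
      then obtain j where j: "min ja jb \<le> j" "j \<le> max ja jb" "dist ?z (q j) \<le> s" by blast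
      have "j \<le> m" "j \<le> \<phi> i + 5100" "\<phi> i \<le> j + 5100" using j a b by (auto simp: min_def max_def split: if_splits)
      then show ?thesis using j(3) s_pos by (intro exI[of _ j]) auto
    qed
  qed
  then obtain \<psi> where g: "\<And>i. i \<le> n \<Longrightarrow> \<psi> i \<le> m" "\<And>i. i \<le> n \<Longrightarrow> dist (p i) (q (\<psi> i)) \<le> 5 * s"
    "\<And>i. i \<le> n \<Longrightarrow> \<psi> i \<le> \<phi> i + 5100" "\<And>i. i \<le> n \<Longrightarrow> \<phi> i \<le> \<psi> i + 5100" by metis
  show ?thesis
    unfolding shadows_def
  proof (intro exI[of _ \<psi>] conjI allI impI)
    fix i assume i: "i < n"
    have "dist (p i) (p (Suc i)) = s" using p i unfolding chain_def by auto
    then have "dist (q (\<psi> i)) (q (\<psi> (Suc i))) \<le> 11 * s"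
      using g(2)[of i] g(2)[of "Suc i"] i dist_triangle[of "q (\<psi> i)" "q (\<psi> (Suc i))" "p i"]
        dist_triangle[of "p i" "q (\<psi> (Suc i))" "p (Suc i)"] by (simp add: dist_commute)
    moreover have "\<psi> i < \<psi> (Suc i) + 50000" "\<psi> (Suc i) < \<psi> i + 50000"
      using g(3,4)[of i] g(3,4)[of "Suc i"] fj i by fastforce+
    ultimately show "\<psi> i \<le> \<psi> (Suc i) + 12" "\<psi> (Suc i) \<le> \<psi> i + 12"
      using chain_index_close[OF q, of "\<psi> i" "\<psi> (Suc i)"] g(1)[of i] g(1)[of "Suc i"] i by auto
  next
    have "dist (q (\<psi> 0)) (q 0) \<le> 11 * s"
      using g(2)[of 0] e0 s_pos dist_triangle[of "q (\<psi> 0)" "q 0" "p 0"] by (simp add: dist_commute)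
    then show "\<psi> 0 \<le> 12" using chain_index_close[OF q, of "\<psi> 0" 0] g(1)[of 0] g(3)[of 0] f0 by auto
    have "dist (q (\<psi> n)) (q m) \<le> 11 * s"
      using g(2)[of n] e1 s_pos dist_triangle[of "q (\<psi> n)" "q m" "p n"] by (simp add: dist_commute)
    then show "m \<le> \<psi> n + 12" using chain_index_close[OF q, of "\<psi> n" m] g(1)[of n] g(4)[of n] f1 by auto
  qed (use g in auto)
qed

definition states :: "'a \<Rightarrow> ((nat \<Rightarrow> 'a) \<times> nat) set" where
  "states b = {(p, n). chain p n \<and> dist (p n) b \<le> s}"

definition fellow :: "(nat \<Rightarrow> 'a) \<times> nat \<Rightarrow> (nat \<Rightarrow> 'a) \<times> nat \<Rightarrow> bool" where
  "fellow = (\<lambda>(p, n) (q, m). dist (p 0) (q 0) \<le> 2 * s \<and> shadows (5 * s) 12 p n q m \<and> shadows (5 * s) 12 q m p n)"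

lemma fellowI:
  assumes "(p, n) \<in> states b" "(q, m) \<in> states b" "dist (p 0) (q 0) \<le> 2 * s"
    "shadows (14 * s) 300 p n q m" "shadows (14 * s) 300 q m p n"
  shows "fellow (p, n) (q, m)"
proof -
  have "dist (p n) (q m) \<le> 2 * s"
    using assms(1,2) dist_triangle2[of "p n" "q m" b] unfolding states_def by auto
  then show ?thesis using shadows_improve[of p n q m] shadows_improve[of q m p n] assms
    unfolding fellow_def states_def by (auto simp: dist_commute)
qed

lemma fellow_trans:
  assumes "u \<in> states b" "v \<in> states b" "w \<in> states b" "fellow u v" "fellow v w" "dist (fst u 0) (fst w 0) \<le> 2 * s"
  shows "fellow u w"
proof -
  obtain p n q m r l where [simp]: "u = (p, n)" "v = (q, m)" "w = (r, l)" by (cases u, cases v, cases w)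
  have "shadows (14 * s) 300 p n r l" "shadows (14 * s) 300 r l p n"
    using assms(4,5) shadows_mono[OF shadows_comp[of "5 * s" 12 p n q m "5 * s" 12 r l], of "14 * s" 300]
      shadows_mono[OF shadows_comp[of "5 * s" 12 r l q m "5 * s" 12 p n], of "14 * s" 300] s_pos
    unfolding fellow_def by auto
  then show ?thesis using assms fellowI[of p n b r l] by simp
qed

lemma fellow_refl:
  assumes "u \<in> states b"
  shows "fellow u u"
proof (cases u)
  case (Pair p n)
  have "shadows (14 * s) 300 p n p n"
    unfolding shadows_def using s_pos by (intro exI[of _ "\<lambda>i. i"]) simp
  then show ?thesis unfolding Pair using assms[unfolded Pair] s_pos by (intro fellowI) auto
qed

lemma fellow_sym: "fellow u v \<Longrightarrow> fellow v u"
  unfolding fellow_def by (auto simp: dist_commute)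

text \<open>Deleting the first point moves the starting point by \<open>s\<close>: a chain is transported along itself.\<close>

lemma fellow_tail:
  assumes "(p, Suc n) \<in> states b"
  shows "(\<lambda>i. p (Suc i), n) \<in> states b" "fellow (p, Suc n) (\<lambda>i. p (Suc i), n)"
proof -
  show t: "(\<lambda>i. p (Suc i), n) \<in> states b"
    using assms chain_shift[of p "Suc n" 1] unfolding states_def by simp
  have s: "dist (p i) (p (Suc i)) = s" if "i \<le> n" for i using assms that unfolding states_def chain_def by simp
  show "fellow (p, Suc n) (\<lambda>i. p (Suc i), n)"
  proof (rule fellowI[OF assms t])
    show "shadows (14 * s) 300 p (Suc n) (\<lambda>i. p (Suc i)) n"
      unfolding shadows_def
    proof (intro exI[of _ "\<lambda>i. i - 1"] conjI allI impI)
      show "dist (p i) (p (Suc (i - 1))) \<le> 14 * s" for i using s[of 0] s_pos by (cases i) auto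
    qed auto
    show "shadows (14 * s) 300 (\<lambda>i. p (Suc i)) n p (Suc n)"
      unfolding shadows_def using s_pos by (intro exI[of _ Suc]) auto
  qed (use s[of 0] s_pos in auto)
qed

section \<open>Transporting a chain to a nearby starting point\<close>

text \<open>The chain started at a new point aims at a vertex ten steps ahead on the old chain, and at the base point once fewer
than ten steps are left.\<close>

definition target :: "(nat \<Rightarrow> 'a) \<Rightarrow> nat \<Rightarrow> 'a \<Rightarrow> nat \<Rightarrow> 'a" where
  "target p n b j = (if j + 10 \<le> n then p (j + 10) else b)"

text \<open>Closeness to \<open>b\<close> is not enough, since the chain may pass near \<open>b\<close> before its end.\<close>

definition arrived :: "nat \<Rightarrow> 'a \<Rightarrow> 'a \<Rightarrow> nat \<Rightarrow> bool" where
  "arrived n b z j \<longleftrightarrow> n < j + 10 \<and> dist z b \<le> s"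

text \<open>One step towards the current target. The bound \<open>3 * s\<close> on the displacement of the target keeps the new chain
straight; the bound by \<open>j' - j\<close> makes \<open>dist z (target j) + (n - j) * s\<close> decrease, so that the
process stops.\<close>

definition sweep_step :: "(nat \<Rightarrow> 'a) \<Rightarrow> nat \<Rightarrow> 'a \<Rightarrow> 'a \<Rightarrow> nat \<Rightarrow> 'a \<Rightarrow> nat \<Rightarrow> bool" where
  "sweep_step p n b z j z' j' \<longleftrightarrow> dist z z' = s \<and>
     dist z' (target p n b j) \<le> dist z (target p n b j) - s + d \<and> j \<le> j' \<and> j' \<le> j + 10 \<and>
     dist (target p n b j) (target p n b j') \<le> real (j' - j) * s \<and>
     dist (target p n b j) (target p n b j') \<le> 3 * s"

lemma target_dist:
  assumes "chain p n" "dist (p n) b \<le> s" "j \<le> n"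
  shows "dist (p j) (target p n b j) \<le> 10 * s"
proof (cases "j + 10 \<le> n")
  case True
  then show ?thesis using chain_dist_le[OF assms(1), of j "j + 10"] by (simp add: target_def)
next
  case False
  have "dist (p j) (p n) \<le> real (n - j) * s" using assms by (intro chain_dist_le) auto
  also have "\<dots> \<le> real 9 * s" using False by (intro mult_scale_mono) auto
  finally show ?thesis using False assms(2) dist_triangle[of "p j" b "p n"] by (simp add: target_def)
qed

lemma target_far:
  assumes p: "chain p n" and z: "dist z (p j) \<le> s" "\<not> arrived n b z j"
  shows "s < dist z (target p n b j)"
proof (cases "j + 10 \<le> n")
  case True
  have "9 * (real (j + 10 - j) * s) \<le> 10 * dist (p j) (p (j + 10))"
    using True by (intro chain_dist_ge[OF p]) auto
  then have "9 * s \<le> dist (p j) (p (j + 10))" by simp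
  then show ?thesis using True z(1) s_pos dist_triangle[of "p j" "p (j + 10)" z]
    by (simp add: target_def dist_commute)
next
  case False then show ?thesis using z by (simp add: target_def arrived_def)
qed

lemma target_shift:
  assumes p: "chain p n" and b: "dist (p n) b \<le> s" and j: "j \<le> j'" "j' \<le> n"
  shows "dist (target p n b j) (target p n b j') \<le> real (j' - j) * s"
proof -
  consider "n < j + 10" | "j' + 10 \<le> n" | "j + 10 \<le> n" "n < j' + 10" by linarith
  then show ?thesis
  proof cases
    case 1 then show ?thesis using j s_pos by (simp add: target_def)
  next
    case 2
    then show ?thesis using j chain_dist_le[OF p, of "j + 10" "j' + 10"] by (simp add: target_def)
  next
    case 3
    have "dist (p (j + 10)) b \<le> real (n - (j + 10)) * s + s"
      using chain_dist_le[OF p, of "j + 10" n] 3 b dist_triangle[of "p (j + 10)" b "p n"] by linarith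
    also have "\<dots> = real (Suc (n - (j + 10))) * s" by (simp add: algebra_simps)
    also have "\<dots> \<le> real (j' - j) * s" using 3 by (intro mult_scale_mono) linarith
    finally show ?thesis using 3 by (simp add: target_def)
  qed
qed

text \<open>After a step of length \<open>s\<close> towards the target, the new point is close to the old chain: in the tripod spanned by
\<open>z\<close>, \<open>p j\<close> and the target, the branch at \<open>z\<close> has length at most about \<open>s\<close> because \<open>p j\<close> is within \<open>s\<close>
of \<open>z\<close>. So the step either ends near \<open>p j\<close> or has entered the branch that follows the chain.\<close>

lemma sweep_step_exists:
  assumes p: "chain p n" and b: "dist (p n) b \<le> s" "b \<in> X" and z: "z \<in> X" "j \<le> n" "dist z (p j) \<le> s"
    and na: "\<not> arrived n b z j"
  obtains z' j' where "z' \<in> X" "j' \<le> n" "sweep_step p n b z j z' j'" "dist z' (p j') \<le> 2 * s"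
    "dist z' (p j') \<le> s \<or> arrived n b z' j'"
proof -
  note result = that
  define t where "t = target p n b j"
  have pX: "\<And>i. i \<le> n \<Longrightarrow> p i \<in> X" using p unfolding chain_def by auto
  have tX: "t \<in> X" using pX b by (simp add: t_def target_def)
  have tf: "s < dist z t" unfolding t_def by (rule target_far[OF p z(3) na])
  have tp: "dist (p j) t \<le> 10 * s" unfolding t_def by (rule target_dist[OF p b(1) z(2)])
  obtain z' where z': "z' \<in> X" "dist z z' = s" "dist z' t \<le> dist z t - s + d"
    using point_at[of z t s d] z tX tf s_pos d_pos by auto
  have zt: "dist z t \<le> 11 * s" using dist_triangle[of z t "p j"] tp z(3) by linarith
  have loc: "dist z' z \<le> s" "dist z' (p j) \<le> 2 * s" "dist z' t \<le> 11 * s"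
    using z' z(3) zt s_large d_pos dist_triangle[of z' "p j" z] by (auto simp: dist_commute)
  have fp: "dist z' (p j) + dist z t \<le> max (dist z' z + dist (p j) t) (dist z' t + dist z (p j)) + 2 * d"
    using z z' pX[OF z(2)] tX loc s_pos by (intro four_point) (auto simp: dist_commute)
  have small: "14 * d < s" using s_large d_pos by linarith
  have finish: thesis if "j \<le> j'" "j' \<le> n" "j' \<le> j + 10" "dist z' (p j') \<le> 2 * s" "dist z' (p j') \<le> s \<or> arrived n b z' j'"
     "j + 10 \<le> n \<Longrightarrow> j' \<le> j + 3" for j'
  proof (rule result[of z' j'])
    have "dist (target p n b j) (target p n b j') \<le> real (j' - j) * s"
      using that by (intro target_shift[OF p b(1)]) auto
    moreover have "dist (target p n b j) (target p n b j') \<le> 3 * s"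
    proof (cases "j + 10 \<le> n")
      case True
      then have "real (j' - j) * s \<le> real 3 * s" using that by (intro mult_scale_mono) auto
      then show ?thesis using calculation by simp
    next
      case False then show ?thesis using that s_pos by (simp add: target_def)
    qed
    ultimately show "sweep_step p n b z j z' j'"
      using z' that unfolding sweep_step_def t_def by auto
  qed (use that z' in auto)
  show thesis
  proof (cases "dist z' (p j) \<le> 3 * d")
    case True
    then show thesis using z small d_pos s_pos by (intro finish[of j]) auto
  next
    case F: False
    then have "dist z' (p j) + dist z t \<le> s + dist (p j) t + 2 * d"
      using fp z' z(3) by (simp add: dist_commute max_def split: if_splits)
    then have c1: "dist z' (p j) + dist z' t \<le> dist (p j) t + 3 * d" using z'(3) by linarith
    show thesis
    proof (cases "j + 10 \<le> n")
      case True
      then have t: "t = p (j + 10)" by (simp add: t_def target_def)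
      have "\<exists>j'. j \<le> j' \<and> j' \<le> j + 10 \<and> dist z' (p j') \<le> s"
        using True c1 d_pos s_pos loc z' unfolding t by (intro near_chain_le[OF p]) auto
      then obtain j' where j': "j \<le> j'" "j' \<le> j + 10" "dist z' (p j') \<le> s" by blast
      have "dist (p j) (p j') \<le> 3 * s"
        using j'(3) loc(2) dist_triangle[of "p j" "p j'" z'] by (simp add: dist_commute)
      moreover have "9 * (real (j' - j) * s) \<le> 10 * dist (p j) (p j')"
        using True j' by (intro chain_dist_ge[OF p]) auto
      ultimately have "(9 * real (j' - j)) * s \<le> 30 * s" unfolding mult.assoc by linarith
      then have "9 * real (j' - j) \<le> 30" using s_pos by (simp only: mult_le_cancel_right_pos)
      then have "real (j' - j) < 4" by linarith
      then have "j' \<le> j + 3" by linarith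
      then show thesis using j' True s_pos by (intro finish[of j']) auto
    next
      case False
      then have t: "t = b" by (simp add: t_def target_def)
      have pn: "dist z' (p n) \<le> 12 * s" using loc(3) t b(1) dist_triangle2[of z' "p n" b] by simp
      have "dist z' (p n) + dist (p j) b \<le> max (dist z' (p j) + dist (p n) b) (dist z' b + dist (p j) (p n)) + 2 * d"
        using z' pX z b loc pn s_pos unfolding t by (intro four_point) auto
      then consider "dist z' (p n) + dist (p j) b \<le> dist z' (p j) + dist (p n) b + 2 * d"
        | "dist z' (p n) + dist (p j) b \<le> dist z' b + dist (p j) (p n) + 2 * d" by linarith
      then show thesis
      proof cases
        case 1
        \<comment> \<open>The new point lies between the last vertex of the old chain and the base point.\<close>
        then have *: "dist z' (p n) + dist z' b \<le> s + 5 * d" using c1 b(1) unfolding t by linarith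
        show thesis
        proof (rule finish[of n])
          show "dist z' (p n) \<le> 2 * s" using * small d_pos s_pos zero_le_dist[of z' b] by linarith
          show "dist z' (p n) \<le> s \<or> arrived n b z' n"
            using * small d_pos unfolding arrived_def by linarith
        qed (use z False in auto)
      next
        case 2
        then have "dist z' (p j) + dist z' (p n) \<le> dist (p j) (p n) + 14 * d" using c1 d_pos unfolding t by linarith
        then have "\<exists>j'. j \<le> j' \<and> j' \<le> n \<and> dist z' (p j') \<le> s"
          using False z z' loc s_pos by (intro near_chain_le[OF p]) auto
        then obtain j' where j': "j \<le> j'" "j' \<le> n" "dist z' (p j') \<le> s" by blast
        show thesis using j' False s_pos by (intro finish[of j']) auto
      qed
    qed
  qed
qed

text \<open>Two consecutive targets are close to each other compared with their distance, so the two steps go in the same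
direction. The quality of the old chain does not enter the estimate, which is why repeated transport does not make
chains worse.\<close>

lemma sweep_straight:
  assumes p: "chain p n" and b: "dist (p n) b \<le> s" "b \<in> X"
    and X: "z0 \<in> X" "z1 \<in> X" "z2 \<in> X" and j: "j0 \<le> n" "j1 \<le> n" "dist z0 (p j0) \<le> s"
    and st: "sweep_step p n b z0 j0 z1 j1" "sweep_step p n b z1 j1 z2 j2" and na: "\<not> arrived n b z1 j1"
  shows "2 * s - 6 * d \<le> dist z0 z2"
proof -
  define t t' where "t = target p n b j0" and "t' = target p n b j1"
  note S = st[unfolded sweep_step_def, folded t_def t'_def]
  have pX: "\<And>i. i \<le> n \<Longrightarrow> p i \<in> X" using p unfolding chain_def by auto
  have tX: "t \<in> X" "t' \<in> X" using pX b by (auto simp: t_def t'_def target_def)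
  have tp: "dist (p j0) t \<le> 10 * s" unfolding t_def by (rule target_dist[OF p b(1) j(1)])
  have loc: "dist z0 t \<le> 11 * s" using dist_triangle[of z0 t "p j0"] tp j(3) by linarith
  have loc2: "dist z1 t \<le> 12 * s" "dist z2 t \<le> 13 * s" "dist z0 z2 \<le> 2 * s"
    using loc S dist_triangle3[of z1 t z0] dist_triangle3[of z2 t z1] dist_triangle[of z0 z2 z1] by (auto simp: dist_commute)
  have f1: "dist z0 t + dist z1 z2 \<le> max (dist z0 z1 + dist t z2) (dist z0 z2 + dist z1 t) + 2 * d"
    using X tX loc loc2 S s_pos by (intro four_point) auto
  have f2: "dist t z2 + dist z1 t' \<le> max (dist t z1 + dist z2 t') (dist t t' + dist z1 z2) + 2 * d"
    using X tX loc loc2 S s_pos by (intro four_point) (auto simp: dist_commute)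
  have far: "dist t t' + 5 * d < dist z1 t + dist z1 t'"
  proof (cases "j0 + 10 \<le> n")
    case True
    have "9 * (real (j0 + 10 - j0) * s) \<le> 10 * dist (p j0) (p (j0 + 10))"
      using True by (intro chain_dist_ge[OF p]) auto
    then have "9 * s \<le> dist (p j0) t" using True by (simp add: t_def target_def)
    moreover have "dist (p j0) t \<le> dist (p j0) z0 + dist z0 z1 + dist z1 t"
      using dist_triangle[of "p j0" t z0] dist_triangle[of z0 t z1] by linarith
    ultimately have "7 * s \<le> dist z1 t" using j(3) S by (simp add: dist_commute)
    moreover have "5 * d < s" using s_large d_pos by linarith
    ultimately show ?thesis using S zero_le_dist[of z1 t'] s_pos by linarith
  next
    case False
    then have "t = b" "t' = b" "s < dist z1 b" using S na by (auto simp: t_def t'_def target_def arrived_def)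
    then show ?thesis using s_large d_pos by simp
  qed
  have "dist t z1 + dist z2 t' \<le> dist z1 t + dist z1 t' - s + d" using S by (simp add: dist_commute)
  then show ?thesis using f1 f2 far S s_large d_pos dist_commute[of z1 t] dist_commute[of t z2]
    by (smt (verit))
qed

text \<open>The steps are iterated, with induction on a bound for the number of steps that remain.\<close>

lemma sweep_exists:
  assumes p: "chain p n" and b: "dist (p n) b \<le> s" "b \<in> X" and y: "y \<in> X" "dist y (p 0) \<le> s"
  obtains w k m where "chain w m" "w 0 = y" "dist (w m) b \<le> s" "k 0 = 0" "n < k m + 10"
    "\<And>i. i \<le> m \<Longrightarrow> k i \<le> n \<and> dist (w i) (p (k i)) \<le> 2 * s"
    "\<And>i. i < m \<Longrightarrow> k i \<le> k (Suc i) \<and> k (Suc i) \<le> k i + 10"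
proof -
  let ?T = "target p n b"
  have run: "\<exists>w k m. w 0 = z \<and> k 0 = j \<and> arrived n b (w m) (k m) \<and>
      (\<forall>i\<le>m. w i \<in> X \<and> k i \<le> n \<and> dist (w i) (p (k i)) \<le> 2 * s) \<and>
      (\<forall>i<m. dist (w i) (p (k i)) \<le> s \<and> \<not> arrived n b (w i) (k i) \<and> sweep_step p n b (w i) (k i) (w (Suc i)) (k (Suc i)))"
    if "z \<in> X" "j \<le> n" "dist z (p j) \<le> 2 * s" "dist z (p j) \<le> s \<or> arrived n b z j"
      "dist z (?T j) + real (n - j) * s \<le> real N * (s / 2)" for N z j
    using that
  proof (induction N arbitrary: z j)
    case 0
    have "0 \<le> real (n - j) * s" using s_pos by simp
    moreover have "dist z (?T j) + real (n - j) * s \<le> 0" using 0(5) by (simp only: of_nat_0 mult_zero_left)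
    ultimately have "dist z (?T j) = 0" "real (n - j) * s = 0"
      using zero_le_dist[of z "?T j"] by linarith+
    then have "arrived n b z j" using s_pos 0(2) by (auto simp: target_def arrived_def)
    then show ?case using 0 by (intro exI[of _ "\<lambda>_. z"] exI[of _ "\<lambda>_. j"] exI[of _ "0::nat"]) auto
  next
    case (Suc N)
    show ?case
    proof (cases "arrived n b z j")
      case True
      then show ?thesis using Suc.prems by (intro exI[of _ "\<lambda>_. z"] exI[of _ "\<lambda>_. j"] exI[of _ "0::nat"]) auto
    next
      case False
      then have zs: "dist z (p j) \<le> s" using Suc.prems by blast
      obtain z' j' where z': "z' \<in> X" "j' \<le> n" "sweep_step p n b z j z' j'" "dist z' (p j') \<le> 2 * s"
          "dist z' (p j') \<le> s \<or> arrived n b z' j'"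
        using sweep_step_exists[OF p b Suc.prems(1,2) zs False] by blast
      note S = z'(3)[unfolded sweep_step_def]
      have "dist z' (?T j') \<le> dist z (?T j) - s + d + real (j' - j) * s"
        using S dist_triangle[of z' "?T j'" "?T j"] by linarith
      moreover have "real (n - j) * s = real (j' - j) * s + real (n - j') * s"
        using S z'(2) by (simp add: of_nat_diff algebra_simps)
      moreover have "real (Suc N) * (s / 2) = real N * (s / 2) + s / 2" by (simp add: algebra_simps)
      moreover have "d \<le> s / 2" using s_large d_pos by linarith
      ultimately have "dist z' (?T j') + real (n - j') * s \<le> real N * (s / 2)"
        using Suc.prems(5) by linarith
      then obtain w k m where w: "w 0 = z'" "k 0 = j'" "arrived n b (w m) (k m)"
        "\<And>i. i \<le> m \<Longrightarrow> w i \<in> X \<and> k i \<le> n \<and> dist (w i) (p (k i)) \<le> 2 * s"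
        "\<And>i. i < m \<Longrightarrow> dist (w i) (p (k i)) \<le> s \<and> \<not> arrived n b (w i) (k i) \<and> sweep_step p n b (w i) (k i) (w (Suc i)) (k (Suc i))"
        using Suc.IH[OF z'(1,2,4,5)] by blast
      show ?thesis
      proof (intro exI conjI allI impI)
        show "case_nat z w 0 = z" "case_nat j k 0 = j" by auto
        show "arrived n b (case_nat z w (Suc m)) (case_nat j k (Suc m))" using w by simp
      next
        fix i assume "i \<le> Suc m"
        then show "case_nat z w i \<in> X" "case_nat j k i \<le> n" "dist (case_nat z w i) (p (case_nat j k i)) \<le> 2 * s"
          using w(4) Suc.prems by (auto split: nat.split)
      next
        fix i assume "i < Suc m"
        then show "dist (case_nat z w i) (p (case_nat j k i)) \<le> s"
          "\<not> arrived n b (case_nat z w i) (case_nat j k i)"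
          "sweep_step p n b (case_nat z w i) (case_nat j k i) (case_nat z w (Suc i)) (case_nat j k (Suc i))"
          using w(1,2,5) Suc.prems zs False z'(3) by (auto split: nat.split)
      qed
    qed
  qed
  obtain N where N: "dist y (?T 0) + real (n - 0) * s \<le> real N * (s / 2)"
    using reals_Archimedean3[of "s / 2"] s_pos by (meson half_gt_zero less_eq_real_def)
  obtain w k m where w: "w 0 = y" "k 0 = 0" "arrived n b (w m) (k m)"
        "\<And>i. i \<le> m \<Longrightarrow> w i \<in> X \<and> k i \<le> n \<and> dist (w i) (p (k i)) \<le> 2 * s"
        "\<And>i. i < m \<Longrightarrow> dist (w i) (p (k i)) \<le> s \<and> \<not> arrived n b (w i) (k i) \<and> sweep_step p n b (w i) (k i) (w (Suc i)) (k (Suc i))"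
    using run[of y 0 N] y s_pos N by auto
  have "2 * s - 6 * d \<le> dist (w i) (w (i + 2))" if "i + 2 \<le> m" for i
    using sweep_straight[OF p b, of "w i" "w (Suc i)" "w (i + 2)" "k i" "k (Suc i)" "k (i + 2)"]
      w(4)[of i] w(4)[of "Suc i"] w(4)[of "i + 2"] w(5)[of i] w(5)[of "Suc i"] that by simp
  then have "chain w m" using w(4,5) unfolding chain_def sweep_step_def by auto
  then show thesis using w unfolding arrived_def sweep_step_def by (intro that[of w m k]) auto
qed

text \<open>A vertex of the old chain is matched with the first vertex of the new one whose index has caught up with it. The
index cannot stay the same for six steps: the ends of these six steps would be within \<open>4 s\<close> of each other, but they
are more than \<open>5 s\<close> apart.\<close>

lemma shadows_converse:
  assumes w: "chain w m" and p: "chain p n" and k0: "k 0 = 0" and km: "n < k m + 10"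
    and kd: "\<And>i. i \<le> m \<Longrightarrow> k i \<le> n \<and> dist (w i) (p (k i)) \<le> 2 * s"
    and kj: "\<And>i. i < m \<Longrightarrow> k i \<le> k (Suc i) \<and> k (Suc i) \<le> k i + 10"
  shows "shadows (14 * s) 300 p n w m"
proof -
  have mono: "k i \<le> k j" if "i \<le> j" "j \<le> m" for i j
    using that
  proof (induction j rule: dec_induct)
    case (step j) then show ?case using kj[of j] by simp
  qed simp
  define \<psi> where "\<psi> i = (LEAST l. m \<le> l \<or> i \<le> k l)" for i
  have P: "m \<le> \<psi> i \<or> i \<le> k (\<psi> i)" for i unfolding \<psi>_def by (rule LeastI[of _ m]) simp
  have le: "\<psi> i \<le> l" if "m \<le> l \<or> i \<le> k l" for i l unfolding \<psi>_def using that by (rule Least_le)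
  have lm: "\<psi> i \<le> m" for i by (rule le) simp
  have less: "k l < i" if "l < \<psi> i" for i l using le[of l i] that by linarith
  have no_stall: "\<not> (k l = i \<and> k (l + 6) = i)" if "l + 6 \<le> m" for l i
  proof
    assume *: "k l = i \<and> k (l + 6) = i"
    have "dist (w l) (w (l + 6)) \<le> 4 * s"
      using kd[of l] kd[of "l + 6"] that * dist_triangle2[of "w l" "w (l + 6)" "p i"] by auto
    moreover have "9 * (real (l + 6 - l) * s) \<le> 10 * dist (w l) (w (l + 6))"
      using that by (intro chain_dist_ge[OF w]) auto
    ultimately show False using s_pos by simp
  qed
  show ?thesis
    unfolding shadows_def
  proof (intro exI[of _ \<psi>] conjI allI impI)
    fix i assume i: "i \<le> n"
    show "\<psi> i \<le> m" by (rule lm)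
    have up: "k (\<psi> i) \<le> i + 10"
    proof (cases "\<psi> i")
      case 0 then show ?thesis using k0 by simp
    next
      case (Suc l)
      then show ?thesis using less[of l i] kj[of l] lm[of i] by auto
    qed
    have lo: "i \<le> k (\<psi> i) + 10"
    proof (cases "m \<le> \<psi> i")
      case True then show ?thesis using lm[of i] km i by auto
    next
      case False then show ?thesis using P[of i] by auto
    qed
    have kn: "k (\<psi> i) \<le> n" "dist (w (\<psi> i)) (p (k (\<psi> i))) \<le> 2 * s" using kd[OF lm[of i]] by auto
    have "dist (p i) (p (k (\<psi> i))) \<le> real 10 * s"
    proof (cases "i \<le> k (\<psi> i)")
      case True
      have "dist (p i) (p (k (\<psi> i))) \<le> real (k (\<psi> i) - i) * s" using True kn by (intro chain_dist_le[OF p])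
      also have "\<dots> \<le> real 10 * s" using up by (intro mult_scale_mono) simp
      finally show ?thesis .
    next
      case False
      have "dist (p (k (\<psi> i))) (p i) \<le> real (i - k (\<psi> i)) * s" using False i by (intro chain_dist_le[OF p]) auto
      also have "\<dots> \<le> real 10 * s" using lo by (intro mult_scale_mono) simp
      finally show ?thesis by (simp add: dist_commute)
    qed
    then show "dist (p i) (w (\<psi> i)) \<le> 14 * s"
      using kn(2) s_pos dist_triangle2[of "p i" "w (\<psi> i)" "p (k (\<psi> i))"] by simp
  next
    fix i assume i: "i < n"
    have "\<psi> i \<le> \<psi> (Suc i)" using P[of "Suc i"] by (intro le) auto
    then show "\<psi> i \<le> \<psi> (Suc i) + 300" by simp
    have "\<psi> (Suc i) \<le> \<psi> i + 6"
    proof (rule ccontr)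
      assume "\<not> \<psi> (Suc i) \<le> \<psi> i + 6"
      then have "\<psi> i + 6 < \<psi> (Suc i)" by simp
      then have 1: "\<psi> i + 6 \<le> m" "k (\<psi> i + 6) \<le> i" using lm[of "Suc i"] less[of "\<psi> i + 6" "Suc i"] by auto
      moreover have "i \<le> k (\<psi> i)" "k (\<psi> i) \<le> k (\<psi> i + 6)" using P[of i] 1 mono[of "\<psi> i" "\<psi> i + 6"] by auto
      ultimately show False using no_stall[of "\<psi> i" i] by simp
    qed
    then show "\<psi> (Suc i) \<le> \<psi> i + 300" by simp
  next
    show "\<psi> 0 \<le> 300" using le[of 0 0] by simp
    have "m \<le> \<psi> n + 6"
    proof (rule ccontr)
      assume "\<not> m \<le> \<psi> n + 6"
      then have 1: "\<psi> n + 6 \<le> m" "\<not> m \<le> \<psi> n" by auto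
      have "n \<le> k (\<psi> n)" "k (\<psi> n) \<le> k (\<psi> n + 6)" "k (\<psi> n + 6) \<le> n"
        using P[of n] 1 mono[of "\<psi> n" "\<psi> n + 6"] kd[of "\<psi> n + 6"] by auto
      then show False using no_stall[of "\<psi> n" n] 1 by simp
    qed
    then show "m \<le> \<psi> n + 300" by simp
  qed
qed

lemma fellow_lift:
  assumes u: "(p, n) \<in> states b" and b: "b \<in> X" and y: "y \<in> X" "dist (p 0) y \<le> s"
  shows "\<exists>v\<in>states b. fst v 0 = y \<and> fellow (p, n) v"
proof -
  have p: "chain p n" "dist (p n) b \<le> s" using u unfolding states_def by auto
  obtain w k m where w: "chain w m" "w 0 = y" "dist (w m) b \<le> s" "k 0 = 0" "n < k m + 10"
    and kd: "\<And>i. i \<le> m \<Longrightarrow> k i \<le> n \<and> dist (w i) (p (k i)) \<le> 2 * s"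
    and kj: "\<And>i. i < m \<Longrightarrow> k i \<le> k (Suc i) \<and> k (Suc i) \<le> k i + 10"
    using sweep_exists[OF p b y(1)] y(2) dist_commute[of y "p 0"] by metis
  have v: "(w, m) \<in> states b" using w unfolding states_def by simp
  have "fellow (p, n) (w, m)"
  proof (rule fellowI[OF u v])
    show "dist (p 0) (w 0) \<le> 2 * s" using y w s_pos by simp
    show "shadows (14 * s) 300 p n w m" by (rule shadows_converse[where w = w and m = m and p = p and n = n and k = k, OF w(1) p(1) w(4,5) kd kj])
    show "shadows (14 * s) 300 w m p n"
      unfolding shadows_def
    proof (intro exI[of _ k] conjI allI impI)
      fix i assume "i \<le> m"
      from kd[OF this] show "k i \<le> n" "dist (w i) (p (k i)) \<le> 14 * s" using s_pos by linarith+
    next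
      fix i assume "i < m"
      from kj[OF this] show "k i \<le> k (Suc i) + 300" "k (Suc i) \<le> k i + 300" by linarith+
    qed (use w in auto)
  qed
  then show ?thesis using v w by (intro bexI[of _ "(w, m)"]) auto
qed

section \<open>Uniqueness of chains\<close>

text \<open>Near-geodesics to the base point give chains along which the distance to \<open>b\<close> decreases at full speed, with total
error \<open>e\<close>; the error is halved at each step.\<close>

lemma descending_chain:
  assumes "x \<in> X" "b \<in> X" "0 < e" "e \<le> d"
  obtains p n where "(p, n) \<in> states b" "p 0 = x" "\<And>i. i \<le> n \<Longrightarrow> dist (p i) b + real i * s \<le> dist x b + e"
proof -
  have run: "\<exists>p n. p 0 = x \<and> (\<forall>i\<le>n. p i \<in> X \<and> dist (p i) b + real i * s \<le> dist x b + e) \<and>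
      (\<forall>i<n. dist (p i) (p (Suc i)) = s) \<and> dist (p n) b \<le> s"
    if "x \<in> X" "0 < e" "e \<le> d" "dist x b \<le> real N * (s / 2)" for N x e
    using that
  proof (induction N arbitrary: x e)
    case 0
    then show ?case using s_pos by (intro exI[of _ "\<lambda>_. x"] exI[of _ "0::nat"]) auto
  next
    case (Suc N)
    show ?case
    proof (cases "dist x b \<le> s")
      case True
      then show ?thesis using Suc.prems by (intro exI[of _ "\<lambda>_. x"] exI[of _ "0::nat"]) auto
    next
      case False
      obtain z where z: "z \<in> X" "dist x z = s" "dist z b \<le> dist x b - s + e / 2"
        using point_at[of x b s "e / 2"] Suc.prems assms(2) False s_pos by auto
      have "real (Suc N) * (s / 2) = real N * (s / 2) + s / 2" by (simp add: algebra_simps)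
      moreover have "e / 2 \<le> s / 2" using Suc.prems s_large d_pos by linarith
      ultimately have "dist z b \<le> real N * (s / 2)" using z(3) Suc.prems(4) by linarith
      then obtain p n where p: "p 0 = z" "\<And>i. i \<le> n \<Longrightarrow> p i \<in> X \<and> dist (p i) b + real i * s \<le> dist z b + e / 2"
        "\<And>i. i < n \<Longrightarrow> dist (p i) (p (Suc i)) = s" "dist (p n) b \<le> s"
        using Suc.IH[of z "e / 2"] z(1) Suc.prems by auto
      show ?thesis
      proof (intro exI conjI allI impI)
        show "case_nat x p 0 = x" by simp
        show "dist (case_nat x p (Suc n)) b \<le> s" using p by simp
        fix i assume i: "i \<le> Suc n"
        show "case_nat x p i \<in> X" using i p Suc.prems by (auto split: nat.split)
        show "dist (case_nat x p i) b + real i * s \<le> dist x b + e"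
        proof (cases i)
          case 0 then show ?thesis using Suc.prems by simp
        next
          case (Suc l)
          then have "dist (p l) b + real l * s \<le> dist z b + e / 2" using p(2)[of l] i by simp
          then show ?thesis using z(3) Suc by (simp add: algebra_simps)
        qed
      next
        fix i assume "i < Suc n"
        then show "dist (case_nat x p i) (case_nat x p (Suc i)) = s"
          using p z by (auto split: nat.split)
      qed
    qed
  qed
  obtain N where "dist x b \<le> real N * (s / 2)"
    using reals_Archimedean3[of "s / 2"] s_pos by (meson half_gt_zero less_eq_real_def)
  then obtain p n where p: "p 0 = x" "\<And>i. i \<le> n \<Longrightarrow> p i \<in> X \<and> dist (p i) b + real i * s \<le> dist x b + e"
        "\<And>i. i < n \<Longrightarrow> dist (p i) (p (Suc i)) = s" "dist (p n) b \<le> s"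
    using run[of x e N] assms by auto
  have le: "dist x (p i) \<le> real i * s" if "i \<le> n" for i
    using that
  proof (induction i)
    case (Suc i)
    then have "dist x (p (Suc i)) \<le> real i * s + s" using dist_triangle[of x "p (Suc i)" "p i"] p(3)[of i] by simp
    then show ?case by (simp add: algebra_simps)
  qed (use p in simp)
  have "2 * s - 6 * d \<le> dist (p i) (p (i + 2))" if i: "i + 2 \<le> n" for i
  proof -
    have "dist x b \<le> real i * s + dist (p i) b" using le[of i] i dist_triangle[of x b "p i"] by simp
    moreover have "dist (p (i + 2)) b + real (i + 2) * s \<le> dist x b + e" using p(2)[of "i + 2"] i by simp
    moreover have "real (i + 2) * s = real i * s + 2 * s" by (simp add: algebra_simps)
    moreover have "dist (p i) b \<le> dist (p i) (p (i + 2)) + dist (p (i + 2)) b" by (rule dist_triangle)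
    ultimately show ?thesis using assms(3,4) d_pos by linarith
  qed
  then have "(p, n) \<in> states b" using p unfolding states_def chain_def by auto
  then show thesis using that p by blast
qed

text \<open>Both chains are transported along themselves to the constant chain at \<open>b\<close>. Hence they lie in the same component of
the covering formed by the classes of chains, and that covering is trivial.\<close>

lemma unique_chain:
  assumes sc: "r_simply_connected s X" and b: "b \<in> X" and u: "u \<in> states b" and v: "v \<in> states b"
    and uv: "dist (fst u 0) (fst v 0) \<le> s"
  shows "fellow u v"
proof -
  interpret sh: sheets X s "states b" "\<lambda>u. fst u 0" fellow
  proof
    show "fst u 0 \<in> X" if "u \<in> states b" for u using that unfolding states_def chain_def by auto
    show "\<exists>v\<in>states b. fst v 0 = y \<and> fellow u v" if "u \<in> states b" "y \<in> X" "dist (fst u 0) y \<le> s" for u y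
      using fellow_lift[of "fst u" "snd u" b y] that b by simp
  qed (use s_pos fellow_refl fellow_sym fellow_trans in blast)+
  have step: "sh.joined u v" if "u \<in> states b" "v \<in> states b" "fellow u v" "dist (fst u 0) (fst v 0) \<le> s" for u v
  proof -
    have X: "fst u 0 \<in> X" "fst v 0 \<in> X" using that sh.pr_in by auto
    obtain f where f: "path f" "path_image f \<subseteq> X" "pathstart f = fst u 0" "pathfinish f = fst v 0"
      "\<And>a c. 0 \<le> a \<Longrightarrow> a \<le> c \<Longrightarrow> c \<le> 1 \<Longrightarrow> dist (fst u 0) (f a) + dist (f a) (f c) + dist (f c) (fst v 0) \<le> dist (fst u 0) (fst v 0) + s"
      using near_geodesic[OF X s_pos] by blast
    show ?thesis
    proof (rule sh.joined_step[OF that(1-3) f(1-4)])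
      fix t :: real assume "t \<in> {0..1}"
      then show "dist (fst u 0) (f t) \<le> s \<or> dist (fst v 0) (f t) \<le> s"
        using f(5)[of t t] that(4) by (auto simp: dist_commute)
    next
      fix t t' :: real assume t: "t \<in> {0..1}" "t' \<in> {0..1}"
      have *: "dist (f a) (f c) \<le> 2 * s" if "0 \<le> a" "a \<le> c" "c \<le> 1" for a c
        using f(5)[OF that] \<open>dist (fst u 0) (fst v 0) \<le> s\<close> zero_le_dist[of "fst u 0" "f a"] zero_le_dist[of "f c" "fst v 0"]
        by linarith
      show "dist (f t) (f t') \<le> 2 * s"
        using *[of t t'] *[of t' t] t by (cases "t \<le> t'") (auto simp: dist_commute)
    qed
  qed
  define triv where "triv = ((\<lambda>_::nat. b), 0::nat)"
  have triv: "triv \<in> states b" using b s_pos unfolding triv_def states_def chain_def by auto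
  have to_triv: "sh.joined (p, n) triv" if "(p, n) \<in> states b" for p n
    using that
  proof (induction n arbitrary: p)
    case 0
    have d0: "dist (p 0) b \<le> s" using 0 unfolding states_def by auto
    have "fellow (p, 0) triv" unfolding triv_def
    proof (rule fellowI[OF 0 triv[unfolded triv_def]])
      show "shadows (14 * s) 300 p 0 (\<lambda>_. b) 0" "shadows (14 * s) 300 (\<lambda>_. b) 0 p 0"
        unfolding shadows_def using d0 s_pos by (intro exI[of _ "\<lambda>_. 0"]; simp add: dist_commute)+
    qed (use d0 s_pos in auto)
    then show ?case using step[OF 0 triv] d0 unfolding triv_def by simp
  next
    case (Suc n)
    have t: "(\<lambda>i. p (Suc i), n) \<in> states b" "fellow (p, Suc n) (\<lambda>i. p (Suc i), n)"
      using fellow_tail[OF Suc.prems] by auto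
    have "dist (p 0) (p (Suc 0)) = s" using Suc.prems unfolding states_def chain_def by auto
    then have "sh.joined (p, Suc n) (\<lambda>i. p (Suc i), n)" using step[OF Suc.prems t] by simp
    then show ?case using sh.joined_trans Suc.IH[OF t(1)] by blast
  qed
  obtain v' where v': "v' \<in> states b" "fst v' 0 = fst u 0" "fellow v v'"
    using sh.R_lift[OF v sh.pr_in[OF u]] uv by (auto simp: dist_commute)
  have "sh.joined u triv" "sh.joined v' triv" using to_triv[of "fst u" "snd u"] to_triv[of "fst v'" "snd v'"] u v' by auto
  then have "sh.joined u v'" using sh.joined_sym sh.joined_trans by blast
  then have "fellow u v'" using sh.joined_imp_R[OF sc] v' by simp
  then show ?thesis using fellow_trans[OF u v'(1) v] fellow_sym[OF v'(3)] uv s_pos by simp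
qed

section \<open>From based to global hyperbolicity\<close>

text \<open>If \<open>b\<close> is far away, all chains from the ball around \<open>x\<close> pass within \<open>5 s\<close> of the point \<open>u\<close> on the chain from \<open>x\<close>, forty
steps ahead. If the geodesic from \<open>y\<close> passes through \<open>v\<close> near \<open>u\<close>, then the differences of the distances to
\<open>u\<close> and \<open>v\<close> are the same at \<open>x\<close> and at \<open>y\<close> up to \<open>2 * d\<close>, since \<open>x\<close> and \<open>y\<close> are far away from
both. So passing through \<open>u\<close> instead of \<open>v\<close> costs at most \<open>2 * d\<close>: the crude bound \<open>5 s\<close> does not
enter the error.\<close>

lemma distance_from_afar:
  assumes sc: "r_simply_connected s X" and X: "b \<in> X" "x \<in> X"
  shows "\<exists>u\<in>X. dist x u \<le> 100 * s \<and> (\<forall>y\<in>X. dist x y \<le> s \<longrightarrow> dist y u + dist u b \<le> dist y b + 3 * d)"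
proof (cases "dist x b \<le> 100 * s")
  case True then show ?thesis using X d_pos by (intro bexI[of _ b]) auto
next
  case False
  obtain p n where p: "(p, n) \<in> states b" "p 0 = x"
    "\<And>i. i \<le> n \<Longrightarrow> dist (p i) b + real i * s \<le> dist x b + d / 2"
    using descending_chain[OF X(2,1), of "d / 2"] d_pos by auto
  have pc: "chain p n" "dist (p n) b \<le> s" using p unfolding states_def by auto
  have "dist x (p n) \<le> real n * s" using chain_dist_le[OF pc(1), of 0 n] p(2) by simp
  then have "99 * s < real n * s" using False pc(2) dist_triangle[of x b "p n"] by linarith
  then have "99 < n" using s_pos by simp
  then have n: "40 \<le> n" by simp
  define u where "u = p 40"
  have u: "u \<in> X" "dist x u \<le> 40 * s" "dist u b + 40 * s \<le> dist x b + d / 2"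
    using pc n p(3)[of 40] chain_dist_le[OF pc(1), of 0 40] p(2) unfolding u_def chain_def by auto
  have "dist y u + dist u b \<le> dist y b + 3 * d" if y: "y \<in> X" "dist x y \<le> s" for y
  proof -
    obtain q m where q: "(q, m) \<in> states b" "q 0 = y"
      "\<And>i. i \<le> m \<Longrightarrow> dist (q i) b + real i * s \<le> dist y b + d / 2"
      using descending_chain[OF y(1) X(1), of "d / 2"] d_pos by auto
    have qc: "chain q m" using q unfolding states_def by auto
    have "fellow (p, n) (q, m)" using unique_chain[OF sc X(1) p(1) q(1)] p q y by simp
    then have "shadows (5 * s) 12 p n q m" unfolding fellow_def by simp
    then obtain j where j: "j \<le> m" "dist u (q j) \<le> 5 * s" unfolding shadows_def u_def using n by blast
    define v where "v = q j"
    have v: "v \<in> X" "dist y v \<le> real j * s" "dist v b + real j * s \<le> dist y b + d / 2"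
      using qc j q(3)[of j] chain_dist_le[OF qc, of 0 j] q(2) unfolding v_def chain_def by auto
    have uv: "dist u v \<le> 5 * s" using j by (simp add: v_def)
    have l: "dist y u \<le> 41 * s" "dist y v \<le> 46 * s"
      using u y uv dist_triangle3[of y u x] dist_triangle[of y v u] by (simp_all add: dist_commute)
    have "dist y u + dist x v \<le> max (dist y x + dist u v) (dist y v + dist x u) + 2 * d"
      using l u v y X s_pos by (intro four_point) (auto simp: dist_commute)
    moreover have "40 * s - d / 2 \<le> dist x u" using u(3) dist_triangle[of x b u] by linarith
    then have "39 * s - d / 2 \<le> dist y u" using y dist_triangle[of x u y] by linarith
    then have "dist y x + dist u v + 2 * d < dist y u + dist x v"
      using y uv s_large d_pos zero_le_dist[of x v] dist_commute[of y x] by linarith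
    ultimately have "dist y u + dist x v \<le> dist y v + dist x u + 2 * d" by linarith
    moreover have "dist x b \<le> dist x v + dist v b" by (rule dist_triangle)
    ultimately show ?thesis using u v by linarith
  qed
  then show ?thesis using u s_pos by (intro bexI[of _ u]) auto
qed

text \<open>The base point may be arbitrarily far away; near \<open>x\<close> it can be replaced by a point within the range of local
hyperbolicity.\<close>

lemma based_four_point:
  assumes sc: "r_simply_connected s X" and X: "b \<in> X" "x \<in> X" "y \<in> X" "z \<in> X" "w \<in> X"
    and l: "dist x y \<le> s" "dist x z \<le> s" "dist x w \<le> s"
  shows "dist y z + dist w b \<le> max (dist y w + dist z b) (dist y b + dist w z) + 5 * d"
proof -
  obtain u where u: "u \<in> X" "dist x u \<le> 100 * s"
    "\<And>y. y \<in> X \<Longrightarrow> dist x y \<le> s \<Longrightarrow> dist y u + dist u b \<le> dist y b + 3 * d"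
    using distance_from_afar[OF sc X(1,2)] by blast
  have "dist y z \<le> 2 * s" "dist y w \<le> 2 * s" "dist y u \<le> 101 * s"
    using l u(2) dist_triangle3[of y z x] dist_triangle3[of y w x] dist_triangle3[of y u x] by linarith+
  then have "dist y z + dist w u \<le> max (dist y w + dist z u) (dist y u + dist w z) + 2 * d"
    using X u s_pos by (intro four_point) auto
  moreover have "dist w b \<le> dist w u + dist u b" by (rule dist_triangle)
  ultimately show ?thesis using u(3)[OF X(3) l(1)] u(3)[OF X(4) l(2)] by linarith
qed

text \<open>Points at prescribed distances on one near-geodesic, so that the total error is \<open>e\<close> and not \<open>e\<close> for each point.\<close>

lemma near_geodesic_points:
  fixes l :: "nat \<Rightarrow> real"
  assumes X: "x \<in> X" "y \<in> X" "0 < e" and l: "0 \<le> l 0" "\<And>i. i < N \<Longrightarrow> l i \<le> l (Suc i)" "l N \<le> dist x y"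
  obtains P where "\<And>i. i \<le> N \<Longrightarrow> P i \<in> X \<and> dist x (P i) = l i \<and> dist (P i) y \<le> dist x y - l i + e"
    "\<And>i. i < N \<Longrightarrow> dist (P i) (P (Suc i)) \<le> l (Suc i) - l i + e"
proof -
  obtain f where f: "path f" "path_image f \<subseteq> X" "pathstart f = x" "pathfinish f = y"
    "\<And>a b. 0 \<le> a \<Longrightarrow> a \<le> b \<Longrightarrow> b \<le> 1 \<Longrightarrow> dist x (f a) + dist (f a) (f b) + dist (f b) y \<le> dist x y + e"
    using near_geodesic[OF X] by blast
  have f01: "f 0 = x" "f 1 = y" using f(3,4) by (auto simp: pathstart_def pathfinish_def)
  have c: "continuous_on {a..1} (\<lambda>t. dist x (f t))" if "0 \<le> a" for a
    using f(1) that unfolding path_def by (intro continuous_intros) (auto elim: continuous_on_subset)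
  have lN: "l i \<le> l N" if "i \<le> N" for i
    using that by (induction i rule: inc_induct) (use l(2) in force)+
  have "\<exists>T. \<forall>n. (0 \<le> T n \<and> T n \<le> 1 \<and> dist x (f (T n)) = l (min n N)) \<and> T n \<le> T (Suc n)"
  proof (rule dependent_nat_choice)
    have "\<exists>t\<ge>0. t \<le> 1 \<and> dist x (f t) = l 0"
      using f01 l(1,3) lN[of 0] c[of 0] by (intro IVT') auto
    then show "\<exists>t. 0 \<le> t \<and> t \<le> 1 \<and> dist x (f t) = l (min 0 N)" by simp
  next
    fix t n assume t: "0 \<le> t \<and> t \<le> 1 \<and> dist x (f t) = l (min n N)"
    have "l (min n N) \<le> l (min (Suc n) N)" using l(2)[of n] by (auto simp: min_def not_less_eq_eq)
    then have "\<exists>t'\<ge>t. t' \<le> 1 \<and> dist x (f t') = l (min (Suc n) N)"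
      using t f01 l(3) lN[of "min (Suc n) N"] c[of t] by (intro IVT') auto
    then obtain t' where "t \<le> t'" "t' \<le> 1" "dist x (f t') = l (min (Suc n) N)" by blast
    then show "\<exists>t'. (0 \<le> t' \<and> t' \<le> 1 \<and> dist x (f t') = l (min (Suc n) N)) \<and> t \<le> t'"
      using t by (intro exI[of _ t']) auto
  qed
  then obtain T where T: "\<And>n. 0 \<le> T n" "\<And>n. T n \<le> 1" "\<And>n. dist x (f (T n)) = l (min n N)" "\<And>n. T n \<le> T (Suc n)"
    by blast
  show thesis
  proof (rule that[of "\<lambda>i. f (T i)"])
    fix i assume i: "i \<le> N"
    have "f (T i) \<in> X" using f(2) T(1,2)[of i] by (auto simp: path_image_def)
    moreover have "dist x (f (T i)) = l i" using T(3)[of i] i by (simp add: min_def)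
    ultimately show "f (T i) \<in> X \<and> dist x (f (T i)) = l i \<and> dist (f (T i)) y \<le> dist x y - l i + e"
      using f(5)[of "T i" "T i"] T(1,2)[of i] by simp
  next
    fix i assume i: "i < N"
    have "dist x (f (T i)) + dist (f (T i)) (f (T (Suc i))) + dist (f (T (Suc i))) y \<le> dist x y + e"
      using T by (intro f(5)) auto
    moreover have "dist x (f (T i)) = l i" "dist x (f (T (Suc i))) = l (Suc i)"
      using T(3)[of i] T(3)[of "Suc i"] i by (simp_all add: min_def)
    ultimately show "dist (f (T i)) (f (T (Suc i))) \<le> l (Suc i) - l i + e"
      using dist_triangle[of x y "f (T (Suc i))"] by linarith
  qed
qed

text \<open>Each step may lose \<open>6 * d\<close>, so adding up the increments would give an error that grows with \<open>N\<close>. Instead the line is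
followed backwards from \<open>W N\<close> together with a near-geodesic from \<open>W N\<close> to \<open>b\<close>. At equal distance from
\<open>b\<close> the two stay within \<open>17 * d\<close>, because a descent of more than that distance brings two points that were
\<open>17 * d\<close> apart together again.\<close>

lemma ascending_line:
  assumes sc: "r_simply_connected s X" and b: "b \<in> X" and W: "\<And>i. i \<le> N \<Longrightarrow> W i \<in> X"
    and t: "s / 4 \<le> t" "t \<le> s / 2" and e: "0 < e" "e \<le> d / 10"
    and WW: "\<And>i. i < N \<Longrightarrow> dist (W i) (W (Suc i)) \<le> t + e"
    and up: "\<And>i. i < N \<Longrightarrow> dist (W i) b + t - 6 * d \<le> dist (W (Suc i)) b"
  shows "dist (W 0) (W N) \<le> dist (W N) b - dist (W 0) b + 17 * d"
proof -
  define h where "h y = dist y b" for y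
  have lip: "h y \<le> dist y y' + h y'" for y y' unfolding h_def by (rule dist_triangle)
  have t6: "25 * d \<le> t" using t s_large by linarith
  define l where "l i = h (W N) - h (W (N - i))" for i
  obtain v where v: "\<And>i. i \<le> N \<Longrightarrow> v i \<in> X \<and> dist (W N) (v i) = l i \<and> dist (v i) b \<le> dist (W N) b - l i + e"
    "\<And>i. i < N \<Longrightarrow> dist (v i) (v (Suc i)) \<le> l (Suc i) - l i + e"
  proof (rule near_geodesic_points[of "W N" b e l N])
    fix i assume i: "i < N"
    have "N - i = Suc (N - Suc i)" using i by simp
    then have "h (W (N - Suc i)) + t - 6 * d \<le> h (W (N - i))" using up[of "N - Suc i"] i unfolding h_def by simp
    then show "l i \<le> l (Suc i)" using t6 d_pos unfolding l_def by linarith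
  qed (use W b e in \<open>auto simp: l_def h_def\<close>)
  have hv: "h (v i) \<le> h (W (N - i)) + e" "h (W (N - i)) \<le> h (v i)" if "i \<le> N" for i
    using v(1)[OF that] lip[of "W N" "v i"] unfolding l_def h_def by auto
  have "dist (W (N - i)) (v i) \<le> 17 * d" if "i \<le> N" for i
    using that
  proof (induction i)
    case 0
    then show ?case using v(1)[of 0] d_pos by (simp add: l_def)
  next
    case (Suc i)
    define w w' where "w = W (N - i)" and "w' = W (N - Suc i)"
    have ii: "N - i = Suc (N - Suc i)" using Suc.prems by simp
    have wX: "w \<in> X" "w' \<in> X" "v i \<in> X" "v (Suc i) \<in> X" using W v Suc.prems unfolding w_def w'_def by auto
    have IH: "dist w (v i) \<le> 17 * d" using Suc unfolding w_def by simp
    have ww: "dist w w' \<le> t + e" "h w' + t - 6 * d \<le> h w"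
      using WW[of "N - Suc i"] up[of "N - Suc i"] Suc.prems unfolding w_def w'_def ii h_def by (auto simp: dist_commute)
    have ww': "h w \<le> h w' + t + e" using lip[of w w'] ww by linarith
    have vv: "dist (v i) (v (Suc i)) \<le> h w - h w' + e" using v(2)[of i] Suc.prems unfolding l_def w_def w'_def by simp
    have H: "h (v i) \<le> h w + e" "h w \<le> h (v i)" "h (v (Suc i)) \<le> h w' + e"
      using hv[of i] hv[of "Suc i"] Suc.prems unfolding w_def w'_def by auto
    have loc: "dist w w \<le> s" "dist w w' \<le> s" "dist w (v i) \<le> s" "dist w (v (Suc i)) \<le> s"
      using ww ww' vv IH t e s_large d_pos dist_triangle[of w "v (Suc i)" "v i"] by auto
    have A: "dist w' (v i) + h w \<le> max (dist w' w + h (v i)) (h w' + dist w (v i)) + 5 * d"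
      unfolding h_def by (rule based_four_point[OF sc b wX(1) wX(2,3,1) loc(2,3,1)])
    have "dist w' w + h (v i) \<le> t + 2 * e + h w" using ww H by (simp add: dist_commute)
    moreover have "h w' + dist w (v i) \<le> t + 2 * e + h w" using ww IH t6 d_pos e by linarith
    ultimately have A': "dist w' (v i) \<le> t + 2 * e + 5 * d" using A by linarith
    have B: "dist w' (v (Suc i)) + h (v i) \<le> max (dist w' (v i) + h (v (Suc i))) (h w' + dist (v i) (v (Suc i))) + 5 * d"
      unfolding h_def by (rule based_four_point[OF sc b wX(1) wX(2,4,3) loc(2,4,3)])
    have "dist w' (v i) + h (v (Suc i)) \<le> h w + 11 * d + 3 * e" using A' H ww by linarith
    moreover have "h w' + dist (v i) (v (Suc i)) \<le> h w + 11 * d + 3 * e" using vv d_pos e by linarith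
    ultimately have "dist w' (v (Suc i)) \<le> 16 * d + 3 * e" using B H by linarith
    then show ?case using e unfolding w'_def by simp
  qed
  from this[of N] have "dist (W 0) (v N) \<le> 17 * d" by simp
  moreover have "dist (W N) (v N) = h (W N) - h (W 0)" using v(1)[of N] by (simp add: l_def)
  ultimately show ?thesis using dist_triangle2[of "W 0" "W N" "v N"] unfolding h_def by linarith
qed

lemma equal_steps:
  assumes X: "w \<in> X" "z \<in> X" "0 < e"
  obtains N t W where "0 < N" "0 \<le> t" "t \<le> s / 2" "N = 1 \<or> s / 4 \<le> t" "W 0 = w" "dist w z = real N * t"
    "\<And>i. i \<le> N \<Longrightarrow> W i \<in> X \<and> dist w (W i) = real i * t \<and> dist (W i) z \<le> dist w z - real i * t + e"
    "\<And>i. i < N \<Longrightarrow> dist (W i) (W (Suc i)) \<le> t + e"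
proof -
  define N where "N = Suc (nat \<lfloor>dist w z / (s / 2)\<rfloor>)"
  define t where "t = dist w z / real N"
  have N: "0 < N" by (simp add: N_def)
  have Nt: "dist w z = real N * t" using N by (simp add: t_def)
  have fl: "real N \<le> dist w z / (s / 2) + 1" "dist w z / (s / 2) < real N"
  proof -
    have "0 \<le> dist w z / (s / 2)" using s_pos by simp
    then have "real N = real_of_int \<lfloor>dist w z / (s / 2)\<rfloor> + 1" unfolding N_def by simp
    then show "real N \<le> dist w z / (s / 2) + 1" "dist w z / (s / 2) < real N" by linarith+
  qed
  have "dist w z < real N * (s / 2)" using fl(2) s_pos by (simp add: field_simps)
  then have t1: "t \<le> s / 2" using N by (simp add: t_def field_simps)
  have t2: "N = 1 \<or> s / 4 \<le> t"
  proof (cases "N = 1")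
    case False
    then have "2 \<le> real N" using N by simp
    then have "real N \<le> 2 * (dist w z / (s / 2))" using fl(1) by linarith
    then have "real N * (s / 4) \<le> dist w z" using s_pos by (simp add: field_simps)
    then show ?thesis using N by (simp add: t_def field_simps)
  qed simp
  have t0: "0 \<le> t" by (simp add: t_def)
  obtain W where W: "\<And>i. i \<le> N \<Longrightarrow> W i \<in> X \<and> dist w (W i) = real i * t \<and> dist (W i) z \<le> dist w z - real i * t + e"
    "\<And>i. i < N \<Longrightarrow> dist (W i) (W (Suc i)) \<le> real (Suc i) * t - real i * t + e"
    by (rule near_geodesic_points[OF X, of "\<lambda>i. real i * t" N]) (use t0 Nt in \<open>auto simp: algebra_simps\<close>)
  have "W 0 = w" using W(1)[of 0] by simp
  moreover have "dist (W i) (W (Suc i)) \<le> t + e" if "i < N" for i using W(2)[OF that] by (simp add: algebra_simps)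
  ultimately show thesis using that[of N t W] N t0 t1 t2 Nt W(1) by blast
qed

text \<open>Once the distance to \<open>b\<close> has increased at full speed for one step, the four-point inequality at the next
point excludes a turn: one of the two neighbours has to be farther from \<open>b\<close>, and it is not the previous one.\<close>

lemma near_geodesic_ascends:
  assumes sc: "r_simply_connected s X" and b: "b \<in> X" and z: "z \<in> X" and e: "0 < e" "e \<le> d / 10"
    and N: "0 < N" and t: "t \<le> s / 2" "N = 1 \<or> s / 4 \<le> t" and W0: "dist (W 0) z = real N * t"
    and W: "\<And>i. i \<le> N \<Longrightarrow> W i \<in> X \<and> dist (W 0) (W i) = real i * t \<and> dist (W i) z \<le> dist (W 0) z - real i * t + e"
    and WW: "\<And>i. i < N \<Longrightarrow> dist (W i) (W (Suc i)) \<le> t + e"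
    and up: "dist (W 0) b + t - 6 * d \<le> dist (W 1) b"
  shows "dist (W 0) z \<le> dist z b - dist (W 0) b + 18 * d"
proof -
  have zN: "dist (W N) z \<le> e" using W[of N] W0 by simp
  have "dist (W 0) (W N) \<le> dist (W N) b - dist (W 0) b + 17 * d"
  proof (cases "N = 1")
    case True
    then show ?thesis using W[of 1] up d_pos by simp
  next
    case False
    then have t4: "s / 4 \<le> t" using t by simp
    have up': "dist (W i) b + t - 6 * d \<le> dist (W (Suc i)) b" if "i < N" for i
      using that
    proof (induction i)
      case 0 then show ?case using up by simp
    next
      case (Suc i)
      have X: "W (Suc i) \<in> X" "W i \<in> X" "W (Suc (Suc i)) \<in> X" using W Suc.prems by auto
      have le: "dist (W (Suc i)) (W i) \<le> t + e" "dist (W (Suc i)) (W (Suc (Suc i))) \<le> t + e"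
        using WW[of i] WW[of "Suc i"] Suc.prems by (auto simp: dist_commute)
      have ts: "t + e \<le> s" using t(1) e s_large d_pos by linarith
      have "dist (W i) (W (Suc (Suc i))) + dist (W (Suc i)) b
         \<le> max (dist (W i) (W (Suc i)) + dist (W (Suc (Suc i))) b) (dist (W i) b + dist (W (Suc i)) (W (Suc (Suc i)))) + 5 * d"
        using le ts s_pos by (intro based_four_point[OF sc b X(1) X(2,3,1)]) auto
      moreover have "2 * t \<le> dist (W i) (W (Suc (Suc i)))"
        using W[of i] W[of "Suc (Suc i)"] Suc.prems dist_triangle[of "W 0" "W (Suc (Suc i))" "W i"] by (simp add: algebra_simps)
      moreover have "dist (W i) b + t - 6 * d \<le> dist (W (Suc i)) b" using Suc by simp
      ultimately show ?case using le e t4 s_large d_pos dist_commute[of "W i" "W (Suc i)"] by linarith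
    qed
    show ?thesis by (rule ascending_line[OF sc b _ t4 t(1) e, of N W]) (use W WW up' in auto)
  qed
  then show ?thesis using zN e d_pos dist_triangle[of "W 0" z "W N"] dist_triangle[of "W N" b z] by linarith
qed

text \<open>At \<open>w\<close> the distance to \<open>b\<close> increases at full speed in at least one of the two directions of the geodesic, by the
four-point inequality for \<open>w\<close> and its two neighbours, and then continues to do so up to the end point.\<close>

lemma slim_triangle:
  assumes sc: "r_simply_connected s X" and X: "b \<in> X" "y \<in> X" "z \<in> X" "w \<in> X"
    and w: "dist y w + dist w z \<le> dist y z + d / 10"
  shows "dist w y \<le> dist y b - dist w b + 18 * d \<or> dist w z \<le> dist z b - dist w b + 18 * d"
proof -
  define e where "e = d / 10"
  have e: "0 < e" "e \<le> d / 10" using d_pos by (auto simp: e_def)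
  obtain N t W where W: "0 < N" "0 \<le> t" "t \<le> s / 2" "N = 1 \<or> s / 4 \<le> t" "W 0 = w" "dist w z = real N * t"
    "\<And>i. i \<le> N \<Longrightarrow> W i \<in> X \<and> dist w (W i) = real i * t \<and> dist (W i) z \<le> dist w z - real i * t + e"
    "\<And>i. i < N \<Longrightarrow> dist (W i) (W (Suc i)) \<le> t + e"
    using equal_steps[OF X(4,3) e(1)] by blast
  obtain M r V where V: "0 < M" "0 \<le> r" "r \<le> s / 2" "M = 1 \<or> s / 4 \<le> r" "V 0 = w" "dist w y = real M * r"
    "\<And>i. i \<le> M \<Longrightarrow> V i \<in> X \<and> dist w (V i) = real i * r \<and> dist (V i) y \<le> dist w y - real i * r + e"
    "\<And>i. i < M \<Longrightarrow> dist (V i) (V (Suc i)) \<le> r + e"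
    using equal_steps[OF X(4,2) e(1)] by blast
  have 1: "W 1 \<in> X" "dist w (W 1) = t" "dist (W 1) z \<le> dist w z - t + e" using W(7)[of 1] W(1) by auto
  have 2: "V 1 \<in> X" "dist w (V 1) = r" "dist (V 1) y \<le> dist w y - r + e" using V(7)[of 1] V(1) by auto
  have "dist y z \<le> dist y (V 1) + dist (V 1) (W 1) + dist (W 1) z"
    using dist_triangle[of y z "V 1"] dist_triangle[of "V 1" z "W 1"] by linarith
  then have "r + t - 3 * e \<le> dist (V 1) (W 1)"
    using w 1 2 unfolding e_def by (simp add: dist_commute)
  moreover have "dist (V 1) (W 1) + dist w b \<le> max (dist (V 1) w + dist (W 1) b) (dist (V 1) b + dist w (W 1)) + 5 * d"
    using 1 2 W(3) V(3) s_pos X by (intro based_four_point[OF sc X(1,4)]) auto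
  ultimately have "dist w b + t - 6 * d \<le> dist (W 1) b \<or> dist w b + r - 6 * d \<le> dist (V 1) b"
    using 1 2 e dist_commute[of "V 1" w] by linarith
  then show ?thesis
  proof
    assume "dist w b + t - 6 * d \<le> dist (W 1) b"
    then show ?thesis
      using near_geodesic_ascends[OF sc X(1,3) e W(1,3,4), of W] W by auto
  next
    assume "dist w b + r - 6 * d \<le> dist (V 1) b"
    then show ?thesis
      using near_geodesic_ascends[OF sc X(1,2) e V(1,3,4), of V] V by auto
  qed
qed

text \<open>On a near-geodesic from \<open>x\<close> to \<open>z\<close> there is a point \<open>w\<close> close to both other sides of the triangle with
vertex \<open>b\<close>, so that \<open>dist w b\<close> is about \<open>(x | z)\<close> at \<open>b\<close>. In the triangle with vertex \<open>y\<close> the point \<open>w\<close> is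
close to the side \<open>[x, y]\<close> or \<open>[y, z]\<close>, and the Gromov product of the end points of that side at \<open>b\<close> is at most
about \<open>dist w b\<close>.\<close>

lemma hyperbolic_of_r_simply_connected:
  assumes sc: "r_simply_connected s X"
  shows "hyperbolic (27 * d) X"
  unfolding hyperbolic_def
proof (intro ballI)
  fix x y z b assume X: "x \<in> X" "y \<in> X" "z \<in> X" "b \<in> X"
  obtain f where f: "path f" "path_image f \<subseteq> X" "pathstart f = x" "pathfinish f = z"
    "\<And>a c. 0 \<le> a \<Longrightarrow> a \<le> c \<Longrightarrow> c \<le> 1 \<Longrightarrow> dist x (f a) + dist (f a) (f c) + dist (f c) z \<le> dist x z + d / 10"
    using near_geodesic[OF X(1,3), of "d / 10"] d_pos by auto
  have f01: "f 0 = x" "f 1 = z" using f(3,4) by (auto simp: pathstart_def pathfinish_def)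
  \<comment> \<open>A zero of \<open>g\<close> is a point at which both alternatives of \<open>slim_triangle\<close> hold.\<close>
  define g where "g t = (dist (f t) x - dist x b) - (dist (f t) z - dist z b)" for t
  have "\<exists>t\<ge>0. t \<le> 1 \<and> g t = 0"
  proof (rule IVT')
    show "continuous_on {0..1} g" using f(1) unfolding g_def path_def by (intro continuous_intros)
    show "g 0 \<le> 0" using f01 dist_triangle[of z b x] by (simp add: g_def dist_commute)
    show "0 \<le> g 1" using f01 dist_triangle[of x b z] by (simp add: g_def dist_commute)
  qed simp
  then obtain t where t: "0 \<le> t" "t \<le> 1" "g t = 0" by blast
  define w where "w = f t"
  have w: "w \<in> X" "dist x w + dist w z \<le> dist x z + d / 10"
    using f(2) f(5)[of t t] t by (auto simp: w_def path_image_def)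
  have "dist w x \<le> dist x b - dist w b + 18 * d" "dist w z \<le> dist z b - dist w b + 18 * d"
    using slim_triangle[OF sc X(4,1,3) w] t(3) unfolding g_def w_def[symmetric] by linarith+
  then have 1: "dist w b \<le> gromov_product x z b + 18 * d"
    using dist_triangle2[of x z w] unfolding gromov_product_def by (simp add: dist_commute field_simps)
  have "gromov_product x y b \<le> dist w b + 9 * d \<or> gromov_product y z b \<le> dist w b + 9 * d"
    using slim_triangle[OF sc X(2,1,3) w]
  proof
    assume "dist w x \<le> dist x y - dist w y + 18 * d"
    moreover have "dist x b \<le> dist w x + dist w b" "dist y b \<le> dist w y + dist w b" by (rule dist_triangle3)+
    ultimately show ?thesis unfolding gromov_product_def by (simp add: field_simps)
  next
    assume "dist w z \<le> dist z y - dist w y + 18 * d"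
    moreover have "dist z b \<le> dist w z + dist w b" "dist y b \<le> dist w y + dist w b" by (rule dist_triangle3)+
    ultimately show ?thesis unfolding gromov_product_def by (simp add: field_simps dist_commute)
  qed
  then show "min (gromov_product x y b) (gromov_product y z b) - 27 * d \<le> gromov_product x z b"
    using 1 by linarith
qed

end

theorem theoremA1:
  fixes X :: "'a::metric_space set" and \<delta> \<sigma> :: real
  assumes "\<delta> \<ge> 0" and "\<sigma> > 10 ^ 7 * \<delta>"
    and "length_space X"
    and "locally_hyperbolic \<sigma> \<delta> X"
    and "r_simply_connected (\<sigma> / 10 ^ 5) X"
  shows "hyperbolic (300 * \<delta>) X"
proof -
  have hyp: "hyperbolic (27 * d) X" if d: "\<delta> < d" "10 ^ 7 * d \<le> \<sigma>" for d
  proof -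
    define s where "s = \<sigma> / 10 ^ 5"
    have s: "100000 * s = \<sigma>" "100 * d \<le> s" using d by (auto simp: s_def field_simps)
    interpret locally_hyperbolic_space X d s
    proof
      show "0 < d" "100 * d \<le> s" using assms(1) d s by auto
      show "\<exists>f. path f \<and> path_image f \<subseteq> X \<and> pathstart f = x \<and> pathfinish f = y \<and>
        (\<forall>a b. 0 \<le> a \<and> a \<le> b \<and> b \<le> 1 \<longrightarrow> dist x (f a) + dist (f a) (f b) + dist (f b) y \<le> dist x y + e)"
        if "x \<in> X" "y \<in> X" "0 < e" for x y e
        using length_space_near_geodesic[OF assms(3) that] .
    next
      fix a b c e assume X: "a \<in> X" "b \<in> X" "c \<in> X" "e \<in> X"
        and l: "dist a b < 100000 * s" "dist a c < 100000 * s" "dist a e < 100000 * s"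
      have pos: "0 < \<sigma>" using l(1) s(1) zero_le_dist[of a b] by linarith
      have "hyperbolic \<delta> (ball a \<sigma> \<inter> X)" using assms(4) X unfolding locally_hyperbolic_def by blast
      then have "min (gromov_product a b e) (gromov_product b c e) - \<delta> \<le> gromov_product a c e"
        using X l pos unfolding s(1) hyperbolic_def by simp
      then have "gromov_product a b e - \<delta> \<le> gromov_product a c e \<or> gromov_product b c e - \<delta> \<le> gromov_product a c e"
        by linarith
      then have "dist a c + dist b e \<le> dist a b + dist c e + 2 * d \<or> dist a c + dist b e \<le> dist a e + dist b c + 2 * d"
        using d(1) unfolding gromov_product_def by argo
      then show "dist a c + dist b e \<le> max (dist a b + dist c e) (dist a e + dist b c) + 2 * d"
        by linarith
    qed
    show ?thesis using hyperbolic_of_r_simply_connected assms(5) unfolding s_def by blast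
  qed
  show ?thesis
    unfolding hyperbolic_def
  proof (intro ballI)
    fix x y z b assume X: "x \<in> X" "y \<in> X" "z \<in> X" "b \<in> X"
    have "min (gromov_product x y b) (gromov_product y z b) - gromov_product x z b \<le> 27 * \<delta>"
    proof (rule field_le_epsilon)
      fix \<epsilon> :: real assume \<epsilon>: "0 < \<epsilon>"
      \<comment> \<open>This lies strictly above \<open>\<delta>\<close> because \<open>\<sigma>\<close> is strictly larger than \<open>10 ^ 7 * \<delta>\<close>.\<close>
      define d where "d = min (\<delta> + \<epsilon> / 27) (\<sigma> / 10 ^ 7)"
      have d: "\<delta> < d" "10 ^ 7 * d \<le> \<sigma>" "27 * d \<le> 27 * \<delta> + \<epsilon>" using assms(2) \<epsilon> by (auto simp: d_def min_def)
      show "min (gromov_product x y b) (gromov_product y z b) - gromov_product x z b \<le> 27 * \<delta> + \<epsilon>"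
        using hyp[OF d(1,2)] X d(3) unfolding hyperbolic_def by fastforce
    qed
    then show "min (gromov_product x y b) (gromov_product y z b) - 300 * \<delta> \<le> gromov_product x z b"
      using assms(1) by linarith
  qed
qed

end
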